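(* Let $K$ be an associative commutative unital ring, let $n\geq 1$, let $A$ be a Poisson algebra over $K$ that is Poisson--Noetherian, and suppose that $(\alpha_1,\delta_1),\ldots,(\alpha_n,\delta_n)$ are Poisson-pairs on $A$. Suppose that, whenever $i\neq j$, each of the maps $\alpha_i$ and $\delta_i$ commutes (under composition) with each of the maps $\alpha_j$ and $\delta_j$. Then the Poisson algebras $$A[x_1;\alpha_1,\delta_1]_{\mathrm{P}}\cdots[x_n;\alpha_n,\delta_n]_{\mathrm{P}}$$ and $$A[x_1^{\pm};\alpha_1,\delta_1]_{\mathrm{P}}\cdots[x_n^{\pm};\alpha_n,\delta_n]_{\mathrm{P}}$$ are Poisson--Noetherian.
   Context: Throughout, $K$ is an associative commutative unital ring. A Poisson algebra is an associative commutative unital $K$-algebra $A$ equipped with a $K$-bilinear operation $\{\cdot,\cdot\}_A\colon A\times A\to A$ (the Poisson bracket) such that for all $a,b,c\in A$: $\{a,a\}_A=0$; $\{a,\{b,c\}_A\}_A=\{\{a,b\}_A,c\}_A+\{b,\{a,c\}_A\}_A$; and $\{a,bc\}_A=\{a,b\}_Ac+b\{a,c\}_A$. A derivation of a $K$-algebra always means a $K$-linear derivation. A derivation $\delta$ of $A$ is a Poisson derivation if $\delta(\{a,b\}_A)=\{\delta(a),b\}_A+\{a,\delta(b)\}_A$ for all $a,b\in A$. A Poisson-pair on $A$ is a pair $(\alpha,\delta)$ of maps $A\to A$ where $\alpha$ is a Poisson derivation of $A$ and $\delta$ is a derivation of $A$ such that, for all $a,b\in A$, $$\delta(\{a,b\}_A)-\{\delta(a),b\}_A-\{a,\delta(b)\}_A=\delta(a)\alpha(b)-\alpha(a)\delta(b).$$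 Iterated extensions: let $(\alpha_1,\delta_1),\ldots,(\alpha_n,\delta_n)$ be Poisson-pairs on $A$ such that, whenever $i\ne j$, each of $\alpha_i,\delta_i$ commutes with each of $\alpha_j,\delta_j$. Then the ordinary polynomial algebra $A[x_1,\ldots,x_n]$ has a unique Poisson algebra structure extending the Poisson bracket of $A$ and satisfying $\{a,x_i\}=\alpha_i(a)x_i+\delta_i(a)$ for all $a\in A$ and $i\in\{1,\ldots,n\}$, and $\{x_i,x_j\}=0$ for all $i,j\in\{1,\ldots,n\}$. This Poisson algebra is denoted $A[x_1;\alpha_1,\delta_1]_{\mathrm{P}}\cdots[x_n;\alpha_n,\delta_n]_{\mathrm{P}}$. Its bracket extends uniquely to a Poisson bracket on the Laurent polynomial algebra $A[x_1^{\pm},\ldots,x_n^{\pm}]$, and the resulting Poisson algebra is denoted $A[x_1^{\pm};\alpha_1,\delta_1]_{\mathrm{P}}\cdots[x_n^{\pm};\alpha_n,\delta_n]_{\mathrm{P}}$. An ideal $I$ of a Poisson algebra $A$ is a Poisson ideal if $\{A,I\}_A\subseteq I$. For $S\subseteq A$, a Poisson ideal is generated by $S$ if it is the intersection of all Poisson ideals of $A$ containing $S$. $A$ is Poisson--Noetherian if every Poisson ideal of $A$ is finitely generated as a Poisson ideal; equivalently, every ascending chain of Poisson ideals of $A$ stabilizes; equivalently, every nonempty collection of Poisson ideals of $A$ contains a maximal element with respect to inclusion. *)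

theory Defs
  imports Main "HOL-Library.Poly_Mapping"
begin

text \<open>
  The sort \<open>{comm_ring, comm_monoid_mult}\<close> is that of associative commutative unital rings.
  The class \<open>comm_ring_1\<close>, and with it the locale \<open>module\<close>, additionally demands \<open>0 \<noteq> 1\<close>
  and would thereby exclude the zero ring. For the same reason the type of polynomials over such
  a ring is only an instance of \<open>comm_ring\<close> (the library constant \<open>1\<close> on it needs \<open>0 \<noteq> 1\<close> in
  the coefficients), so the existence of a unit is a hypothesis of the locale below.
\<close>

locale comm_algebra =
  fixes scale :: "'k::{comm_ring, comm_monoid_mult} \<Rightarrow> 'a::comm_ring \<Rightarrow> 'a"
  assumes unital: "\<exists>e. \<forall>a::'a. e * a = a"
    and scale_add_right: "scale c (a + b) = scale c a + scale c b"
    and scale_add_left: "scale (c + d) a = scale c a + scale d a"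
    and scale_scale: "scale c (scale d a) = scale (c * d) a"
    and scale_one: "scale 1 a = a"
    and scale_mult: "scale c (a * b) = scale c a * b"

locale poisson_algebra = comm_algebra scale
  for scale :: "'k::{comm_ring, comm_monoid_mult} \<Rightarrow> 'a::comm_ring \<Rightarrow> 'a" +
  fixes br :: "'a \<Rightarrow> 'a \<Rightarrow> 'a"
  assumes br_add_left: "br (a + b) c = br a c + br b c"
    and br_add_right: "br a (b + c) = br a b + br a c"
    and br_scale_left: "br (scale r a) b = scale r (br a b)"
    and br_scale_right: "br a (scale r b) = scale r (br a b)"
    and br_self: "br a a = 0"
    and jacobi: "br a (br b c) = br (br a b) c + br b (br a c)"
    and leibniz: "br a (b * c) = br a b * c + b * br a c"

definition derivation ::
  "('k \<Rightarrow> 'a::comm_ring \<Rightarrow> 'a) \<Rightarrow> ('a \<Rightarrow> 'a) \<Rightarrow> bool" where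
  "derivation scale \<delta> \<longleftrightarrow>
     (\<forall>a b. \<delta> (a + b) = \<delta> a + \<delta> b) \<and>
     (\<forall>c a. \<delta> (scale c a) = scale c (\<delta> a)) \<and>
     (\<forall>a b. \<delta> (a * b) = \<delta> a * b + a * \<delta> b)"

definition poisson_derivation ::
  "('k \<Rightarrow> 'a::comm_ring \<Rightarrow> 'a) \<Rightarrow> ('a \<Rightarrow> 'a \<Rightarrow> 'a) \<Rightarrow> ('a \<Rightarrow> 'a) \<Rightarrow> bool" where
  "poisson_derivation scale br \<delta> \<longleftrightarrow>
     derivation scale \<delta> \<and> (\<forall>a b. \<delta> (br a b) = br (\<delta> a) b + br a (\<delta> b))"

definition poisson_pair ::
  "('k \<Rightarrow> 'a::comm_ring \<Rightarrow> 'a) \<Rightarrow> ('a \<Rightarrow> 'a \<Rightarrow> 'a) \<Rightarrow> ('a \<Rightarrow> 'a) \<Rightarrow> ('a \<Rightarrow> 'a) \<Rightarrow> bool" where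
  "poisson_pair scale br \<alpha> \<delta> \<longleftrightarrow>
     poisson_derivation scale br \<alpha> \<and> derivation scale \<delta> \<and>
     (\<forall>a b. \<delta> (br a b) - br (\<delta> a) b - br a (\<delta> b) = \<delta> a * \<alpha> b - \<alpha> a * \<delta> b)"

definition poisson_ideal :: "('a::comm_ring \<Rightarrow> 'a \<Rightarrow> 'a) \<Rightarrow> 'a set \<Rightarrow> bool" where
  "poisson_ideal br I \<longleftrightarrow>
     0 \<in> I \<and> (\<forall>x\<in>I. \<forall>y\<in>I. x + y \<in> I) \<and> (\<forall>x\<in>I. - x \<in> I) \<and>
     (\<forall>a. \<forall>x\<in>I. a * x \<in> I) \<and> (\<forall>a. \<forall>x\<in>I. br a x \<in> I)"

definition poisson_ideal_generated :: "('a::comm_ring \<Rightarrow> 'a \<Rightarrow> 'a) \<Rightarrow> 'a set \<Rightarrow> 'a set" where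
  "poisson_ideal_generated br S = \<Inter>{J. poisson_ideal br J \<and> S \<subseteq> J}"

locale poisson_noetherian = poisson_algebra scale br
  for scale :: "'k::{comm_ring, comm_monoid_mult} \<Rightarrow> 'a::comm_ring \<Rightarrow> 'a"
    and br :: "'a \<Rightarrow> 'a \<Rightarrow> 'a" +
  assumes finitely_generated:
    "poisson_ideal br I \<Longrightarrow> \<exists>S. finite S \<and> I = poisson_ideal_generated br S"

text \<open>
  Variables are indexed by a finite type \<open>'n\<close>. Multiplication on both types is convolution,
  as given by the library's ring structure on \<open>\<Rightarrow>\<^sub>0\<close>.
\<close>

type_synonym ('n, 'a) polynomials = "('n \<Rightarrow>\<^sub>0 nat) \<Rightarrow>\<^sub>0 'a"
type_synonym ('n, 'a) laurent_polynomials = "('n \<Rightarrow>\<^sub>0 int) \<Rightarrow>\<^sub>0 'a"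

definition coeff_scale :: "('k \<Rightarrow> 'a::zero \<Rightarrow> 'a) \<Rightarrow> 'k \<Rightarrow> ('e \<Rightarrow>\<^sub>0 'a) \<Rightarrow> ('e \<Rightarrow>\<^sub>0 'a)" where
  "coeff_scale scale c = Poly_Mapping.map (scale c)"

definition Const :: "'a::zero \<Rightarrow> ('n, 'a) polynomials" where
  "Const a = Poly_Mapping.single 0 a"

definition Var :: "'n \<Rightarrow> ('n, 'a::{comm_ring, comm_monoid_mult}) polynomials" where
  "Var i = Poly_Mapping.single (Poly_Mapping.single i 1) 1"

definition laurent_of_poly :: "('n, 'a::comm_ring) polynomials \<Rightarrow> ('n, 'a) laurent_polynomials" where
  "laurent_of_poly f =
     (\<Sum>u \<in> Poly_Mapping.keys f.
        Poly_Mapping.single (Poly_Mapping.map int u) (Poly_Mapping.lookup f u))"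

text \<open>
  The two brackets are given by their defining properties. The first definite description denotes
  as soon as the pairs are Poisson-pairs commuting for distinct indices; the second one denotes
  as soon as the first one does.
\<close>

definition poisson_poly_bracket ::
  "('k::{comm_ring, comm_monoid_mult} \<Rightarrow> 'a::{comm_ring, comm_monoid_mult} \<Rightarrow> 'a) \<Rightarrow>
   ('a \<Rightarrow> 'a \<Rightarrow> 'a) \<Rightarrow> ('n::finite \<Rightarrow> 'a \<Rightarrow> 'a) \<Rightarrow> ('n \<Rightarrow> 'a \<Rightarrow> 'a) \<Rightarrow>
   ('n, 'a) polynomials \<Rightarrow> ('n, 'a) polynomials \<Rightarrow> ('n, 'a) polynomials" where
  "poisson_poly_bracket scale br \<alpha> \<delta> =
     (THE B. poisson_algebra (coeff_scale scale) B \<and>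
        (\<forall>a b. B (Const a) (Const b) = Const (br a b)) \<and>
        (\<forall>a i. B (Const a) (Var i) = Const (\<alpha> i a) * Var i + Const (\<delta> i a)) \<and>
        (\<forall>i j. B (Var i) (Var j) = 0))"

definition poisson_laurent_bracket ::
  "('k::{comm_ring, comm_monoid_mult} \<Rightarrow> 'a::{comm_ring, comm_monoid_mult} \<Rightarrow> 'a) \<Rightarrow>
   ('a \<Rightarrow> 'a \<Rightarrow> 'a) \<Rightarrow> ('n::finite \<Rightarrow> 'a \<Rightarrow> 'a) \<Rightarrow> ('n \<Rightarrow> 'a \<Rightarrow> 'a) \<Rightarrow>
   ('n, 'a) laurent_polynomials \<Rightarrow> ('n, 'a) laurent_polynomials \<Rightarrow>
   ('n, 'a) laurent_polynomials" where
  "poisson_laurent_bracket scale br \<alpha> \<delta> =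
     (THE B. poisson_algebra (coeff_scale scale) B \<and>
        (\<forall>f g. B (laurent_of_poly f) (laurent_of_poly g) =
           laurent_of_poly (poisson_poly_bracket scale br \<alpha> \<delta> f g)))"

end

theory Submission
  imports Defs Complex_Main
begin

text \<open>
  There are two things to show: that the brackets exist, so that the definite descriptions denote,
  and that a Hilbert basis argument works for Poisson ideals.

  \<^emph>\<open>The brackets.\<close> On the Laurent polynomials let \<open>P\<close> be the bracket of \<open>A\<close> acting on coefficients,
  let \<open>E\<^sub>i = x\<^sub>i d/dx\<^sub>i\<close>, and let \<open>D\<^sub>i = \<alpha>\<^sub>i + x\<^sub>i\<^sup>-\<^sup>1 \<delta>\<^sub>i\<close> with \<open>\<alpha>\<^sub>i, \<delta>\<^sub>i\<close> acting on coefficients. The bracket is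
  \<open>{f, g} = P f g + (\<Sum>i. D\<^sub>i f * E\<^sub>i g - E\<^sub>i f * D\<^sub>i g)\<close>. By the defining identity of a Poisson-pair,
  \<open>D\<^sub>i\<close> is not quite a derivation of \<open>P\<close>; the defect is exactly what the commutator
  \<open>E\<^sub>i D\<^sub>i - D\<^sub>i E\<^sub>i = - x\<^sub>i\<^sup>-\<^sup>1 \<delta>\<^sub>i\<close> contributes to the Jacobi identity, and the two cancel
  (\<open>poisson_algebra_twist\<close>). Operators of different indices commute, so the summands can be
  added one at a time (\<open>poisson_algebra_iterated_twist\<close>). The inverse of \<open>x\<^sub>i\<close> makes this
  closed form a Laurent one, hence the polynomial bracket is obtained by restriction. Uniqueness
  holds because a Poisson bracket is a derivation in each argument: it is determined by its values
  on generators, and it extends in at most one way along inverting monomials.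

  \<^emph>\<open>The chain condition.\<close> Fix a monomial order. For a Poisson ideal \<open>I\<close> of the polynomial algebra
  and an exponent \<open>u\<close>, let \<open>I\<^sub>u\<close> consist of the \<open>c\<close> such that some \<open>c x\<^sup>u + (lower terms)\<close> lies in \<open>I\<close>.
  Since \<open>{a, c x\<^sup>u} = ({a, c} + t c) x\<^sup>u + (lower terms)\<close> with \<open>t = (\<Sum>i. u\<^sub>i \<alpha>\<^sub>i a)\<close>, and since \<open>t c\<close>
  lies in \<open>I\<^sub>u\<close> anyway, \<open>I\<^sub>u\<close> is a Poisson ideal of \<open>A\<close> (\<open>poisson_ideal_leading_coeffs\<close>). It grows
  when \<open>u\<close> is replaced by a multiple, so Dickson's lemma and the chain condition in \<open>A\<close>
  leave finitely many exponents at which it jumps (\<open>finitely_many_jumps\<close>). Elements of \<open>I\<close> whose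
  leading coefficients generate these finitely many \<open>I\<^sub>u\<close> generate a Poisson ideal with the
  same leading coefficients as \<open>I\<close>, which is therefore \<open>I\<close>. Finally, a Poisson ideal of the Laurent
  polynomials is generated by the polynomials that it contains.
\<close>

section \<open>Coefficientwise structure on monoid algebras\<close>

text \<open>
  Every operation below is additive in each argument, so this rule reduces identities between
  them to single terms \<open>a x\<^sup>u\<close>, one argument at a time. The zero mapping is the term with coefficient \<open>0\<close>.
\<close>

lemma poly_mapping_sum_induct [case_names single add]:
  assumes "\<And>u a. P (Poly_Mapping.single u a)"
    and "\<And>f g. P f \<Longrightarrow> P g \<Longrightarrow> P (f + g)"
  shows "P (f :: 'e \<Rightarrow>\<^sub>0 'a::comm_monoid_add)"
proof (induction f rule: update_induct)
  case const
  show ?case using assms(1)[of undefined 0] by simp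
next
  case (update f a b)
  have "Poly_Mapping.update a b f = f + Poly_Mapping.single a b"
    using update(1)
    by (intro poly_mapping_eqI) (auto simp: lookup_update lookup_add lookup_single when_def in_keys_iff)
  then show ?case using assms update by simp
qed

definition monomial_extend ::
  "('e \<Rightarrow> 'a::ab_group_add \<Rightarrow> 'b::ab_group_add) \<Rightarrow> ('e \<Rightarrow>\<^sub>0 'a) \<Rightarrow> 'b" where
  "monomial_extend \<phi> f = (\<Sum>u\<in>Poly_Mapping.keys f. \<phi> u (Poly_Mapping.lookup f u))"

lemma additive_monomial_extend:
  assumes "\<And>u. additive (\<phi> u)"
  shows "additive (monomial_extend \<phi>)"
  unfolding monomial_extend_def
  by (intro additive.intro setsum_keys_plus_distrib) (simp_all add: assms additive.add additive.zero)

lemma monomial_extend_single: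
  assumes "\<And>u. additive (\<phi> u)"
  shows "monomial_extend \<phi> (Poly_Mapping.single u a) = \<phi> u a"
  by (simp add: monomial_extend_def assms additive.zero)

lemma lookup_map_zero:
  assumes "h 0 = 0"
  shows "Poly_Mapping.lookup (Poly_Mapping.map h f) u = h (Poly_Mapping.lookup f u)"
  using assms by (simp add: map.rep_eq when_def)

lemma additive_map:
  assumes "additive h"
  shows "additive (Poly_Mapping.map h)"
  by (intro additive.intro poly_mapping_eqI)
     (simp add: assms additive.zero additive.add lookup_map_zero lookup_add)

lemma map_single_additive:
  assumes "additive h"
  shows "Poly_Mapping.map h (Poly_Mapping.single u a) = Poly_Mapping.single u (h a)"
  by (simp add: assms additive.zero)

context comm_algebra
begin

lemma additive_scale: "additive (scale c)"
  by (simp add: additive_def scale_add_right)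

lemma additive_coeff_scale: "additive (coeff_scale scale c)"
  unfolding coeff_scale_def by (rule additive_map) (rule additive_scale)

lemma coeff_scale_single:
  "coeff_scale scale c (Poly_Mapping.single u a) = Poly_Mapping.single u (scale c a)"
  unfolding coeff_scale_def by (rule map_single_additive) (rule additive_scale)

lemma comm_algebra_coeff_scale:
  "comm_algebra (coeff_scale scale :: 'k \<Rightarrow> ('e::comm_monoid_add \<Rightarrow>\<^sub>0 'a) \<Rightarrow> _)"
proof
  obtain e where e: "\<And>a::'a. e * a = a" using unital by blast
  have "Poly_Mapping.single 0 e * f = f" for f :: "'e \<Rightarrow>\<^sub>0 'a"
    by (induction f rule: poly_mapping_sum_induct) (simp_all add: distrib_left mult_single e)
  then show "\<exists>e. \<forall>f::'e \<Rightarrow>\<^sub>0 'a. e * f = f" by blast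
next
  fix c d and f g :: "'e \<Rightarrow>\<^sub>0 'a"
  note add = additive.add[OF additive_coeff_scale]
  show "coeff_scale scale c (f + g) = coeff_scale scale c f + coeff_scale scale c g" by (rule add)
  show "coeff_scale scale (c + d) f = coeff_scale scale c f + coeff_scale scale d f"
    by (induction f rule: poly_mapping_sum_induct)
       (simp_all add: add coeff_scale_single scale_add_left single_add algebra_simps)
  show "coeff_scale scale c (coeff_scale scale d f) = coeff_scale scale (c * d) f"
    by (induction f rule: poly_mapping_sum_induct)
       (simp_all add: add coeff_scale_single scale_scale)
  show "coeff_scale scale 1 f = f"
    by (induction f rule: poly_mapping_sum_induct)
       (simp_all add: add coeff_scale_single scale_one)
  have *: "coeff_scale scale c (f * Poly_Mapping.single v b) = coeff_scale scale c f * Poly_Mapping.single v b"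
    for v b
    by (induction f rule: poly_mapping_sum_induct)
       (simp_all add: add coeff_scale_single mult_single scale_mult algebra_simps)
  show "coeff_scale scale c (f * g) = coeff_scale scale c f * g"
    by (induction g rule: poly_mapping_sum_induct) (rule *, simp add: add algebra_simps)
qed

end

lemma derivation_additive: "derivation scale h \<Longrightarrow> additive h"
  by (simp add: derivation_def additive_def)

lemma (in comm_algebra) derivation_map:
  assumes "derivation scale h"
  shows "derivation (coeff_scale scale :: _ \<Rightarrow> ('e::comm_monoid_add \<Rightarrow>\<^sub>0 'a) \<Rightarrow> _) (Poly_Mapping.map h)"
proof -
  note h = derivation_additive[OF assms]
  note add = additive.add[OF additive_map[OF h]] additive.add[OF additive_coeff_scale]
  note single = map_single_additive[OF h] coeff_scale_single
  have hs: "h (scale c a) = scale c (h a)" and hm: "h (a * b) = h a * b + a * h b" for c a b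
    using assms by (auto simp: derivation_def)
  have hs_map: "Poly_Mapping.map h (coeff_scale scale c f) = coeff_scale scale c (Poly_Mapping.map h f)"
    for c and f :: "'e \<Rightarrow>\<^sub>0 'a"
    by (induction f rule: poly_mapping_sum_induct) (simp_all add: add single hs)
  have *: "Poly_Mapping.map h (f * Poly_Mapping.single v b) =
      Poly_Mapping.map h f * Poly_Mapping.single v b + f * Poly_Mapping.map h (Poly_Mapping.single v b)"
    for v b and f :: "'e \<Rightarrow>\<^sub>0 'a"
    by (induction f rule: poly_mapping_sum_induct) (simp_all add: single mult_single hm single_add, simp_all add: add algebra_simps)
  have "Poly_Mapping.map h (f * g) = Poly_Mapping.map h f * g + f * Poly_Mapping.map h g"
    for f g :: "'e \<Rightarrow>\<^sub>0 'a"
    by (induction g rule: poly_mapping_sum_induct) (rule *, simp add: add algebra_simps)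
  with hs_map show ?thesis by (simp add: derivation_def add)
qed

text \<open>
  The monomials are central for this bracket: it is the extension of scalars of the bracket of
  \<open>A\<close> to the monoid algebra.
\<close>

definition coeff_bracket ::
  "('a::ab_group_add \<Rightarrow> 'a \<Rightarrow> 'a) \<Rightarrow> ('e::comm_monoid_add \<Rightarrow>\<^sub>0 'a) \<Rightarrow> ('e \<Rightarrow>\<^sub>0 'a) \<Rightarrow> ('e \<Rightarrow>\<^sub>0 'a)" where
  "coeff_bracket br f g =
     monomial_extend (\<lambda>u a. monomial_extend (\<lambda>v b. Poly_Mapping.single (u + v) (br a b)) g) f"

context poisson_algebra
begin

lemma br_antisym: "br a b = - br b a"
proof -
  have "0 = br (a + b) (a + b)" by (simp add: br_self)
  also have "\<dots> = br a b + br b a" unfolding br_add_left br_add_right by (simp add: br_self)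
  finally show ?thesis by (simp add: eq_neg_iff_add_eq_0)
qed

lemma additive_br_right: "additive (br a)"
  and additive_br_left: "additive (\<lambda>a. br a b)"
  by (simp_all add: additive_def br_add_left br_add_right)

lemma leibniz_left: "br (a * b) c = a * br b c + br a c * b"
  using leibniz[of c a b] br_antisym[of "a * b" c] br_antisym[of a c] br_antisym[of b c]
  by (simp add: algebra_simps)

lemma additive_coeff_bracket_inner:
  "additive (monomial_extend (\<lambda>v b. Poly_Mapping.single (u + v) (br a b)))"
  by (rule additive_monomial_extend) (simp add: additive_def br_add_right single_add)

lemma coeff_bracket_inner_single:
  "monomial_extend (\<lambda>v b. Poly_Mapping.single (u + v) (br a b)) (Poly_Mapping.single v b) =
    Poly_Mapping.single (u + v) (br a b)"
  by (rule monomial_extend_single) (simp add: additive_def br_add_right single_add)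

lemma coeff_bracket_inner_add:
  "monomial_extend (\<lambda>v c. Poly_Mapping.single (u + v) (br (a + b) c)) g =
    monomial_extend (\<lambda>v c. Poly_Mapping.single (u + v) (br a c)) g +
    monomial_extend (\<lambda>v c. Poly_Mapping.single (u + v) (br b c)) g"
  by (simp add: monomial_extend_def br_add_left single_add sum.distrib)

lemma coeff_bracket_add_left: "coeff_bracket br (f + g) h = coeff_bracket br f h + coeff_bracket br g h"
  unfolding coeff_bracket_def
  by (rule additive.add[OF additive_monomial_extend])
     (simp add: additive_def coeff_bracket_inner_add)

lemma coeff_bracket_add_right: "coeff_bracket br h (f + g) = coeff_bracket br h f + coeff_bracket br h g"
  by (simp add: coeff_bracket_def additive.add[OF additive_coeff_bracket_inner])
     (simp add: monomial_extend_def sum.distrib)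

lemma coeff_bracket_single:
  "coeff_bracket br (Poly_Mapping.single u a) (Poly_Mapping.single v b) = Poly_Mapping.single (u + v) (br a b)"
  unfolding coeff_bracket_def
  by (rule trans[OF monomial_extend_single])
     (simp add: additive_def coeff_bracket_inner_add, rule coeff_bracket_inner_single)

lemma poisson_algebra_coeff_bracket:
  "poisson_algebra (coeff_scale scale :: 'k \<Rightarrow> ('e::comm_monoid_add \<Rightarrow>\<^sub>0 'a) \<Rightarrow> _) (coeff_bracket br)"
proof -
  interpret R: comm_algebra "coeff_scale scale :: 'k \<Rightarrow> ('e \<Rightarrow>\<^sub>0 'a) \<Rightarrow> _"
    by (rule comm_algebra_coeff_scale)
  let ?B = "coeff_bracket br :: ('e \<Rightarrow>\<^sub>0 'a) \<Rightarrow> _"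
  note add = coeff_bracket_add_left coeff_bracket_add_right additive.add[OF additive_coeff_scale]
  note single = coeff_bracket_single mult_single coeff_scale_single
  show ?thesis
  proof
    fix f g h :: "'e \<Rightarrow>\<^sub>0 'a" and r
    show "?B (f + g) h = ?B f h + ?B g h" "?B f (g + h) = ?B f g + ?B f h" by (rule add)+
    have *: "?B (coeff_scale scale r f) (Poly_Mapping.single v b) = coeff_scale scale r (?B f (Poly_Mapping.single v b))" for v b
      by (induction f rule: poly_mapping_sum_induct) (simp_all add: add single br_scale_left)
    show "?B (coeff_scale scale r f) g = coeff_scale scale r (?B f g)"
      by (induction g rule: poly_mapping_sum_induct) (rule *, simp add: add)
    have *: "?B f (coeff_scale scale r (Poly_Mapping.single v b)) = coeff_scale scale r (?B f (Poly_Mapping.single v b))" for v b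
      by (induction f rule: poly_mapping_sum_induct) (simp_all add: add single br_scale_right)
    show "?B f (coeff_scale scale r g) = coeff_scale scale r (?B f g)"
      by (induction g rule: poly_mapping_sum_induct) (rule *, simp add: add)
    have *: "?B (Poly_Mapping.single u a) (Poly_Mapping.single v b) = - ?B (Poly_Mapping.single v b) (Poly_Mapping.single u a)" for u v a b
      by (simp add: single br_antisym[of a b] single_uminus add.commute)
    have **: "?B f (Poly_Mapping.single v b) = - ?B (Poly_Mapping.single v b) f" for f v b
      by (induction f rule: poly_mapping_sum_induct) (rule *, simp add: add)
    have asym: "?B f g = - ?B g f" for f g
      by (induction g rule: poly_mapping_sum_induct) (rule **, simp add: add)
    show "?B f f = 0"
      by (induction f rule: poly_mapping_sum_induct)
         (simp_all add: single br_self add, metis asym add.right_inverse)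
    have 1: "?B (Poly_Mapping.single u a) (?B (Poly_Mapping.single v b) h) = ?B (?B (Poly_Mapping.single u a) (Poly_Mapping.single v b)) h
        + ?B (Poly_Mapping.single v b) (?B (Poly_Mapping.single u a) h)" for u a v b
      by (induction h rule: poly_mapping_sum_induct) (simp_all add: add single, simp_all add: jacobi[of a b] single_add ac_simps)
    have 2: "?B (Poly_Mapping.single u a) (?B g h) = ?B (?B (Poly_Mapping.single u a) g) h
        + ?B g (?B (Poly_Mapping.single u a) h)" for u a
      by (induction g rule: poly_mapping_sum_induct) (rule 1, simp add: add ac_simps)
    show "?B f (?B g h) = ?B (?B f g) h + ?B g (?B f h)"
      by (induction f rule: poly_mapping_sum_induct) (rule 2, simp add: add ac_simps)
    have 1: "?B (Poly_Mapping.single u a) (Poly_Mapping.single v b * h) = ?B (Poly_Mapping.single u a) (Poly_Mapping.single v b) * h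
        + Poly_Mapping.single v b * (?B (Poly_Mapping.single u a) h)" for u a v b
      by (induction h rule: poly_mapping_sum_induct) (simp_all add: add single leibniz single_add, simp_all add: algebra_simps add)
    have 2: "?B (Poly_Mapping.single u a) (g * h) = (?B (Poly_Mapping.single u a) g) * h
        + g * (?B (Poly_Mapping.single u a) h)" for u a
      by (induction g rule: poly_mapping_sum_induct) (rule 1, simp add: add algebra_simps)
    show "?B f (g * h) = ?B f g * h + g * ?B f h"
      by (induction f rule: poly_mapping_sum_induct) (rule 2, simp add: add algebra_simps)
  qed
qed

end

section \<open>Twisting a Poisson bracket by a pair of derivations\<close>

context poisson_algebra
begin

lemmas br_diff_right = additive.diff[OF additive_br_right]
lemmas br_diff_left = additive.diff[OF additive_br_left]

text \<open>
  The bivector \<open>D \<and> E\<close> is Poisson up to the term \<open>D \<and> E \<and> [D, E] = D \<and> E \<and> \<gamma>\<close>, and its mixed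
  term with the given bracket is \<open>E\<close> wedged with the defect of \<open>D\<close> as a derivation of that
  bracket, which is \<open>\<gamma> \<and> D \<and> E\<close> up to sign. The hypotheses are such that the two cancel. For the
  extension by one variable, \<open>\<gamma> = x\<^sup>-\<^sup>1 \<delta>\<close> and \<open>D = \<alpha> + \<gamma>\<close>; as \<open>\<gamma> \<and> \<gamma> = 0\<close>, the defect
  \<open>\<gamma> \<and> D\<close> equals \<open>\<gamma> \<and> \<alpha>\<close>, the right-hand side in the definition of a Poisson-pair.
\<close>

lemma poisson_algebra_twist:
  assumes D: "derivation scale D" and E: "derivation scale E"
    and E_br: "\<And>f g. E (br f g) = br (E f) g + br f (E g)"
    and D_br: "\<And>f g. D (br f g) = br (D f) g + br f (D g) + (\<gamma> f * D g - D f * \<gamma> g)"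
    and ED: "\<And>f. E (D f) = D (E f) - \<gamma> f"
  shows "poisson_algebra scale (\<lambda>f g. br f g + (D f * E g - E f * D g))"
proof
  have scale_mult_right: "scale c (a * b) = a * scale c b" for c a b
    by (metis scale_mult mult.commute)
  note scale_add_minus = scale_add_right additive.diff[OF additive_scale]
  have D_rules: "D (a + b) = D a + D b" "D (scale c a) = scale c (D a)"
    "D (a * b) = D a * b + a * D b" "D (a - b) = D a - D b" for a b c
    using D additive.diff[OF derivation_additive[OF D]] by (auto simp: derivation_def)
  have E_rules: "E (a + b) = E a + E b" "E (scale c a) = scale c (E a)"
    "E (a * b) = E a * b + a * E b" "E (a - b) = E a - E b" for a b c
    using E additive.diff[OF derivation_additive[OF E]] by (auto simp: derivation_def)
  note rules = D_rules E_rules br_add_left br_add_right br_diff_left br_diff_right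
  fix f g h r
  show "br (f + g) h + (D (f + g) * E h - E (f + g) * D h) =
      br f h + (D f * E h - E f * D h) + (br g h + (D g * E h - E g * D h))"
    by (simp add: rules algebra_simps)
  show "br f (g + h) + (D f * E (g + h) - E f * D (g + h)) =
      br f g + (D f * E g - E f * D g) + (br f h + (D f * E h - E f * D h))"
    by (simp add: rules algebra_simps)
  show "br (scale r f) g + (D (scale r f) * E g - E (scale r f) * D g) =
      scale r (br f g + (D f * E g - E f * D g))"
    by (simp add: rules br_scale_left scale_add_minus scale_mult)
  show "br f (scale r g) + (D f * E (scale r g) - E f * D (scale r g)) =
      scale r (br f g + (D f * E g - E f * D g))"
    by (simp add: rules br_scale_right scale_add_minus scale_mult_right)
  show "br f f + (D f * E f - E f * D f) = 0"
    by (simp add: br_self mult.commute)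
  show "br f (g * h) + (D f * E (g * h) - E f * D (g * h)) =
      (br f g + (D f * E g - E f * D g)) * h + g * (br f h + (D f * E h - E f * D h))"
    by (simp add: rules leibniz algebra_simps)
  show "br f (br g h + (D g * E h - E g * D h)) +
      (D f * E (br g h + (D g * E h - E g * D h)) - E f * D (br g h + (D g * E h - E g * D h))) =
      br (br f g + (D f * E g - E f * D g)) h +
      (D (br f g + (D f * E g - E f * D g)) * E h - E (br f g + (D f * E g - E f * D g)) * D h) +
      (br g (br f h + (D f * E h - E f * D h)) +
       (D g * E (br f h + (D f * E h - E f * D h)) - E g * D (br f h + (D f * E h - E f * D h))))"
    \<comment> \<open>The two instances of antisymmetry orient the mixed terms alike; everything then cancels formally.\<close>
    by (simp only: rules D_br E_br ED leibniz leibniz_left jacobi[of f g h]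
        br_antisym[of g "D f"] br_antisym[of g "E f"])
       (simp add: algebra_simps)
qed

end

text \<open>
  The step from \<open>F\<close> to \<open>insert j F\<close> is the single twist, applied to the bracket already
  twisted by \<open>F\<close>. The operators of index \<open>j\<close> commute with those that were added, so they interact
  with the twisted bracket as they do with \<open>P\<close>.
\<close>

lemma poisson_algebra_iterated_twist:
  fixes D E \<gamma> :: "'n \<Rightarrow> 'a::comm_ring \<Rightarrow> 'a"
  assumes P: "poisson_algebra scale P"
    and D: "\<And>i. derivation scale (D i)" and E: "\<And>i. derivation scale (E i)"
    and E_P: "\<And>i f g. E i (P f g) = P (E i f) g + P f (E i g)"
    and D_P: "\<And>i f g. D i (P f g) = P (D i f) g + P f (D i g) + (\<gamma> i f * D i g - D i f * \<gamma> i g)"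
    and ED: "\<And>i f. E i (D i f) = D i (E i f) - \<gamma> i f"
    and comm: "\<And>i j f. i \<noteq> j \<Longrightarrow> D i (D j f) = D j (D i f)"
      "\<And>i j f. i \<noteq> j \<Longrightarrow> D i (E j f) = E j (D i f)"
      "\<And>i j f. i \<noteq> j \<Longrightarrow> E i (E j f) = E j (E i f)"
    and F: "finite F"
  shows "poisson_algebra scale (\<lambda>f g. P f g + (\<Sum>i\<in>F. D i f * E i g - E i f * D i g))"
    (is "poisson_algebra scale (?B F)")
  using F
proof (induction F)
  case empty
  then show ?case using P by simp
next
  case (insert j F)
  have D_rules: "D i (a * b) = D i a * b + a * D i b" "D i (a - b) = D i a - D i b"
      "D i (a + b) = D i a + D i b" "D i (sum h F) = (\<Sum>x\<in>F. D i (h x))" for i a b h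
    using D[of i] additive.diff[OF derivation_additive[OF D]] additive.sum[OF derivation_additive[OF D]]
    by (auto simp: derivation_def)
  have E_rules: "E i (a * b) = E i a * b + a * E i b" "E i (a - b) = E i a - E i b"
      "E i (a + b) = E i a + E i b" "E i (sum h F) = (\<Sum>x\<in>F. E i (h x))" for i a b h
    using E[of i] additive.diff[OF derivation_additive[OF E]] additive.sum[OF derivation_additive[OF E]]
    by (auto simp: derivation_def)
  have commute: "D j (D i f) = D i (D j f)" "D j (E i f) = E i (D j f)"
      "E j (D i f) = D i (E j f)" "E j (E i f) = E i (E j f)" if "i \<in> F" for i f
  proof -
    have "i \<noteq> j" using insert.hyps that by auto
    then show "D j (D i f) = D i (D j f)" "D j (E i f) = E i (D j f)"
      "E j (D i f) = D i (E j f)" "E j (E i f) = E i (E j f)"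
      by (simp_all add: comm)
  qed
  interpret B: poisson_algebra scale "?B F" by (rule insert.IH)
  have "E j (?B F f g) = ?B F (E j f) g + ?B F f (E j g)" for f g
    by (simp add: D_rules E_rules E_P sum.distrib[symmetric])
       (rule sum.cong, simp_all add: commute algebra_simps)
  moreover have "D j (?B F f g) = ?B F (D j f) g + ?B F f (D j g) + (\<gamma> j f * D j g - D j f * \<gamma> j g)" for f g
    by (simp add: D_rules E_rules D_P sum.distrib[symmetric])
       (rule sum.cong, simp_all add: commute algebra_simps)
  ultimately have "poisson_algebra scale (\<lambda>f g. ?B F f g + (D j f * E j g - E j f * D j g))"
    by (intro B.poisson_algebra_twist[where \<gamma>="\<gamma> j"] D E ED)
  then show ?case using insert.hyps by (simp add: ac_simps)
qed

section \<open>The bracket on Laurent polynomials\<close>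

text \<open>
  The ring homomorphism from the integers. It replaces \<open>of_int\<close>, whose type class excludes the
  zero ring.
\<close>

definition int_image :: "int \<Rightarrow> 'a::{comm_ring, comm_monoid_mult}" where
  "int_image k = ((+) 1 ^^ nat k) 0 - ((+) 1 ^^ nat (- k)) 0"

lemma int_image_0 [simp]: "int_image 0 = 0"
  and int_image_1 [simp]: "int_image 1 = 1"
  by (simp_all add: int_image_def)

lemma int_image_succ: "int_image (k + 1) = int_image k + 1"
proof (cases "k \<ge> 0")
  case True
  then show ?thesis by (simp add: int_image_def nat_add_distrib algebra_simps)
next
  case False
  then have "nat (- k) = Suc (nat (- (k + 1)))" by simp
  with False show ?thesis by (simp add: int_image_def algebra_simps)
qed

lemma int_image_pred: "int_image (k - 1) = int_image k - 1"
  by (metis int_image_succ add_diff_cancel_right' diff_add_cancel)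

lemma int_image_add: "int_image (k + l) = int_image k + int_image l"
proof (induction l rule: int_induct[where k=0])
  case (step1 l)
  then show ?case by (simp add: int_image_succ add.assoc[symmetric])
next
  case (step2 l)
  then show ?case by (simp add: int_image_pred add_diff_eq)
qed simp

lemma additive_int_image_eq_0:
  assumes "additive h" "h 1 = 0"
  shows "h (int_image k) = 0"
proof (induction k rule: int_induct[where k=0])
  case (step1 k)
  then show ?case using assms by (simp add: int_image_succ additive.add)
next
  case (step2 k)
  then show ?case using assms by (simp add: int_image_pred additive.diff)
qed (simp add: assms additive.zero)

text \<open>
  The product rule makes \<open>h 1\<close> vanish, hence the value of \<open>h\<close> at every integer.
\<close>

lemma derivation_int_image_mult:
  fixes h :: "'a::{comm_ring, comm_monoid_mult} \<Rightarrow> 'a"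
  assumes "additive h" and "\<And>a b. h (a * b) = h a * b + a * h b"
  shows "h (int_image k * a) = int_image k * h a"
proof -
  have "h 1 = 0" using assms(2)[of 1 1] by simp
  then have "h (int_image k) = 0" using assms(1) by (rule additive_int_image_eq_0[rotated])
  then show ?thesis by (simp add: assms(2))
qed

text \<open>
  The derivation \<open>x\<^sub>i d/dx\<^sub>i\<close>.
\<close>

definition euler :: "'n \<Rightarrow> ('n, 'a::{comm_ring, comm_monoid_mult}) laurent_polynomials \<Rightarrow> ('n, 'a) laurent_polynomials"
  where "euler i = monomial_extend (\<lambda>u a. Poly_Mapping.single u (int_image (Poly_Mapping.lookup u i) * a))"

lemma additive_euler: "additive (euler i)"
  unfolding euler_def
  by (rule additive_monomial_extend) (simp add: additive_def single_add distrib_left)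

lemma euler_single:
  "euler i (Poly_Mapping.single u a) = Poly_Mapping.single u (int_image (Poly_Mapping.lookup u i) * a)"
  unfolding euler_def
  by (rule monomial_extend_single) (simp add: additive_def single_add distrib_left)

lemma euler_mult: "euler i (f * g) = euler i f * g + f * euler i g"
proof -
  note add = additive.add[OF additive_euler]
  have *: "euler i (f * Poly_Mapping.single v b) =
      euler i f * Poly_Mapping.single v b + f * euler i (Poly_Mapping.single v b)" for v and b :: 'b
    by (induction f rule: poly_mapping_sum_induct)
       (simp_all add: euler_single mult_single int_image_add lookup_add single_add[symmetric],
        simp_all add: add algebra_simps)
  show ?thesis
    by (induction g rule: poly_mapping_sum_induct) (rule *, simp add: add algebra_simps)
qed

definition var_inverse :: "'n \<Rightarrow> ('n, 'a::{comm_ring, comm_monoid_mult}) laurent_polynomials" where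
  "var_inverse i = Poly_Mapping.single (Poly_Mapping.single i (- 1)) 1"

locale commuting_poisson_pairs = poisson_algebra scale br
  for scale :: "'k::{comm_ring, comm_monoid_mult} \<Rightarrow> 'a::{comm_ring, comm_monoid_mult} \<Rightarrow> 'a"
    and br :: "'a \<Rightarrow> 'a \<Rightarrow> 'a" +
  fixes \<alpha> \<delta> :: "'n::finite \<Rightarrow> 'a \<Rightarrow> 'a"
  assumes pair: "poisson_pair scale br (\<alpha> i) (\<delta> i)"
    and commuting: "i \<noteq> j \<Longrightarrow>
           \<alpha> i \<circ> \<alpha> j = \<alpha> j \<circ> \<alpha> i \<and> \<alpha> i \<circ> \<delta> j = \<delta> j \<circ> \<alpha> i \<and>
           \<delta> i \<circ> \<alpha> j = \<alpha> j \<circ> \<delta> i \<and> \<delta> i \<circ> \<delta> j = \<delta> j \<circ> \<delta> i"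
begin

definition shifted_\<delta> :: "'n \<Rightarrow> ('n, 'a) laurent_polynomials \<Rightarrow> ('n, 'a) laurent_polynomials" where
  "shifted_\<delta> i f = var_inverse i * Poly_Mapping.map (\<delta> i) f"

text \<open>
  The operator \<open>D\<^sub>i\<close>. It is the derivation \<open>{-, x\<^sub>i}\<close> divided by \<open>x\<^sub>i\<close>: on coefficients
  \<open>{a, x\<^sub>i} = \<alpha>\<^sub>i a x\<^sub>i + \<delta>\<^sub>i a = D\<^sub>i a x\<^sub>i\<close>, and both kill the variables.
\<close>

definition var_action :: "'n \<Rightarrow> ('n, 'a) laurent_polynomials \<Rightarrow> ('n, 'a) laurent_polynomials" where
  "var_action i f = Poly_Mapping.map (\<alpha> i) f + shifted_\<delta> i f"

definition laurent_bracket ::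
  "('n, 'a) laurent_polynomials \<Rightarrow> ('n, 'a) laurent_polynomials \<Rightarrow> ('n, 'a) laurent_polynomials" where
  "laurent_bracket f g = coeff_bracket br f g +
     (\<Sum>i\<in>UNIV. var_action i f * euler i g - euler i f * var_action i g)"

lemma derivation_\<alpha>: "derivation scale (\<alpha> i)" and derivation_\<delta>: "derivation scale (\<delta> i)"
  and \<alpha>_br: "\<alpha> i (br a b) = br (\<alpha> i a) b + br a (\<alpha> i b)"
  using pair[of i] by (auto simp: poisson_pair_def poisson_derivation_def)

lemma \<delta>_br: "\<delta> i (br a b) = br (\<delta> i a) b + br a (\<delta> i b) + (\<delta> i a * \<alpha> i b - \<alpha> i a * \<delta> i b)"
proof -
  have "\<delta> i (br a b) - br (\<delta> i a) b - br a (\<delta> i b) = \<delta> i a * \<alpha> i b - \<alpha> i a * \<delta> i b"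
    using pair[of i] by (auto simp: poisson_pair_def)
  then show ?thesis by (simp add: algebra_simps)
qed

lemmas additive_\<alpha> = derivation_additive[OF derivation_\<alpha>]
lemmas additive_\<delta> = derivation_additive[OF derivation_\<delta>]

lemma \<alpha>_mult: "\<alpha> i (a * b) = \<alpha> i a * b + a * \<alpha> i b"
  and \<delta>_mult: "\<delta> i (a * b) = \<delta> i a * b + a * \<delta> i b"
  using derivation_\<alpha>[of i] derivation_\<delta>[of i] by (auto simp: derivation_def)

lemma \<alpha>_int_image: "\<alpha> i (int_image k * a) = int_image k * \<alpha> i a"
  and \<delta>_int_image: "\<delta> i (int_image k * a) = int_image k * \<delta> i a"
  by (rule derivation_int_image_mult; simp add: additive_\<alpha> additive_\<delta> \<alpha>_mult \<delta>_mult)+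

lemma br_int_image: "br b (int_image k * a) = int_image k * br b a"
  by (rule derivation_int_image_mult) (simp_all add: additive_br_right leibniz)

lemma br_int_image_left: "br (int_image k * a) b = int_image k * br a b"
  using br_int_image[of b k a] br_antisym[of "int_image k * a" b] br_antisym[of a b] by simp

lemma var_action_single:
  "var_action i (Poly_Mapping.single u a) =
     Poly_Mapping.single u (\<alpha> i a) + Poly_Mapping.single (u + Poly_Mapping.single i (- 1)) (\<delta> i a)"
  by (simp add: var_action_def shifted_\<delta>_def var_inverse_def map_single_additive additive_\<alpha> additive_\<delta>
      mult_single add.commute)

lemma shifted_\<delta>_single:
  "shifted_\<delta> i (Poly_Mapping.single u a) = Poly_Mapping.single (u + Poly_Mapping.single i (- 1)) (\<delta> i a)"
  by (simp add: shifted_\<delta>_def var_inverse_def map_single_additive additive_\<delta> mult_single add.commute)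

lemma additive_shifted_\<delta>: "additive (shifted_\<delta> i)"
  by (simp add: additive_def shifted_\<delta>_def additive.add[OF additive_map[OF additive_\<delta>]] distrib_left)

lemma additive_var_action: "additive (var_action i)"
  by (simp add: additive_def var_action_def additive.add[OF additive_map[OF additive_\<alpha>]]
      additive.add[OF additive_shifted_\<delta>])

abbreviation laurent_scale :: "'k \<Rightarrow> ('n, 'a) laurent_polynomials \<Rightarrow> ('n, 'a) laurent_polynomials" where
  "laurent_scale \<equiv> coeff_scale scale"

sublocale laurent: comm_algebra laurent_scale
  by (rule comm_algebra_coeff_scale)

lemma derivation_var_action: "derivation laurent_scale (var_action i)"
proof -
  note d = derivation_map[OF derivation_\<alpha>, of i, where 'e = "'n \<Rightarrow>\<^sub>0 int"]
    derivation_map[OF derivation_\<delta>, of i, where 'e = "'n \<Rightarrow>\<^sub>0 int"]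
  have "var_inverse i * laurent_scale c f = laurent_scale c (var_inverse i * f)" for c f
    by (metis laurent.scale_mult mult.commute)
  with d show ?thesis
    by (simp add: derivation_def var_action_def shifted_\<delta>_def laurent.scale_add_right algebra_simps)
qed

lemma derivation_euler: "derivation laurent_scale (euler i)"
proof -
  have scale_mult_right: "scale c (a * b) = a * scale c b" for c a b
    by (metis mult.commute scale_mult)
  have "euler i (laurent_scale c f) = laurent_scale c (euler i f)" for c f
    by (induction f rule: poly_mapping_sum_induct)
       (simp_all add: euler_single coeff_scale_single scale_mult_right
         additive.add[OF additive_euler] laurent.scale_add_right)
  then show ?thesis by (simp add: derivation_def euler_mult additive.add[OF additive_euler])
qed

text \<open>
  All hypotheses of the iterated twist are identities between additive maps, checked on
  single terms \<open>a x\<^sup>u\<close>. The commutator of \<open>E\<^sub>i\<close> and \<open>D\<^sub>i\<close> arises because multiplication by \<open>x\<^sub>i\<^sup>-\<^sup>1\<close>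
  lowers the \<open>i\<close>-th exponent by one, while \<open>E\<^sub>i\<close> commutes with all operators on coefficients.
\<close>

lemma poisson_algebra_laurent_bracket: "poisson_algebra laurent_scale laurent_bracket"
proof -
  let ?P = "coeff_bracket br :: ('n, 'a) laurent_polynomials \<Rightarrow> _"
  note add = coeff_bracket_add_left coeff_bracket_add_right additive.add[OF additive_euler]
    additive.add[OF additive_var_action] additive.add[OF additive_shifted_\<delta>]
  note single = coeff_bracket_single euler_single var_action_single shifted_\<delta>_single
  have 1: "euler i (?P f (Poly_Mapping.single v b)) =
      ?P (euler i f) (Poly_Mapping.single v b) + ?P f (euler i (Poly_Mapping.single v b))" for i f v b
    by (induction f rule: poly_mapping_sum_induct)
       (simp_all add: single br_int_image br_int_image_left int_image_add lookup_add
          single_add[symmetric] distrib_right, simp_all add: add ac_simps)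
  have E_P: "euler i (?P f g) = ?P (euler i f) g + ?P f (euler i g)" for i f g
    by (induction g rule: poly_mapping_sum_induct) (rule 1, simp add: add ac_simps)
  have 2: "var_action i (?P f (Poly_Mapping.single v b)) =
      ?P (var_action i f) (Poly_Mapping.single v b) + ?P f (var_action i (Poly_Mapping.single v b)) +
      (shifted_\<delta> i f * var_action i (Poly_Mapping.single v b) -
       var_action i f * shifted_\<delta> i (Poly_Mapping.single v b))" for i f v b
    by (induction f rule: poly_mapping_sum_induct)
       (simp add: single add mult_single \<alpha>_br \<delta>_br single_add single_diff algebra_simps,
        simp add: add algebra_simps)
  \<comment> \<open>The Poisson-pair identity, with \<open>\<alpha>\<^sub>i\<close> replaced by \<open>D\<^sub>i\<close>, as their difference is \<open>x\<^sub>i\<^sup>-\<^sup>1 \<delta>\<^sub>i\<close>.\<close>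
  have D_P: "var_action i (?P f g) = ?P (var_action i f) g + ?P f (var_action i g) +
      (shifted_\<delta> i f * var_action i g - var_action i f * shifted_\<delta> i g)" for i f g
    by (induction g rule: poly_mapping_sum_induct) (rule 2, simp add: add algebra_simps)
  have ED: "euler i (var_action i f) = var_action i (euler i f) - shifted_\<delta> i f" for i f
    by (induction f rule: poly_mapping_sum_induct)
       (simp add: single add \<alpha>_int_image \<delta>_int_image lookup_add int_image_pred
          left_diff_distrib single_diff, simp add: add algebra_simps)
  have DD: "var_action i (var_action j f) = var_action j (var_action i f)" if "i \<noteq> j" for i j f
  proof -
    have "\<alpha> i (\<alpha> j a) = \<alpha> j (\<alpha> i a)" "\<alpha> i (\<delta> j a) = \<delta> j (\<alpha> i a)"
      "\<delta> i (\<alpha> j a) = \<alpha> j (\<delta> i a)" "\<delta> i (\<delta> j a) = \<delta> j (\<delta> i a)" for a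
      using commuting[OF that] by (auto simp: fun_eq_iff)
    then show ?thesis
      by (induction f rule: poly_mapping_sum_induct) (simp_all add: single add ac_simps)
  qed
  have DE: "var_action i (euler j f) = euler j (var_action i f)" if "i \<noteq> j" for i j f
    by (induction f rule: poly_mapping_sum_induct)
       (use that in \<open>simp_all add: single add \<alpha>_int_image \<delta>_int_image lookup_add lookup_single\<close>)
  have EE: "euler i (euler j f) = euler j (euler i f)" for i j f
    by (induction f rule: poly_mapping_sum_induct) (simp_all add: single add ac_simps)
  show ?thesis
    unfolding laurent_bracket_def[abs_def]
    by (rule poisson_algebra_iterated_twist[where \<gamma> = shifted_\<delta>])
       (simp_all add: poisson_algebra_coeff_bracket derivation_var_action derivation_euler E_P D_P ED DE,
        simp_all add: DD EE)
qed

end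

section \<open>Restriction to polynomials and uniqueness of the brackets\<close>

lemma laurent_of_poly_eq_extend:
  "laurent_of_poly = monomial_extend (\<lambda>u a. Poly_Mapping.single (Poly_Mapping.map int u) a)"
  by (simp add: fun_eq_iff laurent_of_poly_def monomial_extend_def)

lemma additive_laurent_of_poly: "additive laurent_of_poly"
  unfolding laurent_of_poly_eq_extend
  by (rule additive_monomial_extend) (simp add: additive_def single_add)

lemma laurent_of_poly_single:
  "laurent_of_poly (Poly_Mapping.single u a) = Poly_Mapping.single (Poly_Mapping.map int u) a"
  unfolding laurent_of_poly_eq_extend
  by (rule monomial_extend_single) (simp add: additive_def single_add)

lemma lookup_map_int: "Poly_Mapping.lookup (Poly_Mapping.map int u) i = int (Poly_Mapping.lookup u i)"
  by (simp add: lookup_map_zero)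

lemma map_int_add: "Poly_Mapping.map int (u + v) = Poly_Mapping.map int u + Poly_Mapping.map int v"
  by (rule poly_mapping_eqI) (simp add: lookup_map_int lookup_add)

lemma map_int_zero: "Poly_Mapping.map int 0 = 0"
  by (rule poly_mapping_eqI) (simp add: lookup_map_int)

lemma map_int_inject: "Poly_Mapping.map int u = Poly_Mapping.map int v \<longleftrightarrow> u = v"
  by (metis lookup_map_int of_nat_eq_iff poly_mapping_eqI)

lemma laurent_of_poly_mult: "laurent_of_poly (f * g) = laurent_of_poly f * laurent_of_poly g"
proof -
  note add = additive.add[OF additive_laurent_of_poly]
  have *: "laurent_of_poly (f * Poly_Mapping.single v b) =
      laurent_of_poly f * laurent_of_poly (Poly_Mapping.single v b)" for v b
    by (induction f rule: poly_mapping_sum_induct)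
       (simp_all add: mult_single laurent_of_poly_single map_int_add, simp add: add algebra_simps)
  show ?thesis
    by (induction g rule: poly_mapping_sum_induct) (rule *, simp add: add algebra_simps)
qed

lemma lookup_laurent_of_poly:
  "Poly_Mapping.lookup (laurent_of_poly f) (Poly_Mapping.map int u) = Poly_Mapping.lookup f u"
  by (induction f rule: poly_mapping_sum_induct)
     (simp_all add: laurent_of_poly_single lookup_single map_int_inject lookup_add
       additive.add[OF additive_laurent_of_poly])

lemma inj_laurent_of_poly: "inj laurent_of_poly"
  by (rule injI, rule poly_mapping_eqI) (metis lookup_laurent_of_poly)

lemma laurent_of_poly_Const: "laurent_of_poly (Const a) = Poly_Mapping.single 0 a"
  by (simp add: Const_def laurent_of_poly_single map_int_zero)

lemma laurent_of_poly_Var: "laurent_of_poly (Var i) = Poly_Mapping.single (Poly_Mapping.single i 1) 1"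
  by (simp add: Var_def laurent_of_poly_single)

lemma single_add_exponent_Var:
  "Poly_Mapping.single (u + Poly_Mapping.single i 1) a = Poly_Mapping.single u a * Var i"
  by (simp add: Var_def mult_single)

lemma exponent_induct [case_names zero Var]:
  fixes u :: "'n \<Rightarrow>\<^sub>0 nat"
  assumes "P 0" and step: "\<And>u i. P u \<Longrightarrow> P (u + Poly_Mapping.single i 1)"
  shows "P u"
proof -
  have "P v \<Longrightarrow> P (v + u)" for v
  proof (induction u arbitrary: v rule: poly_mapping_sum_induct)
    case (single i n)
    have "P (v + Poly_Mapping.single i n)"
    proof (induction n)
      case (Suc n)
      from step[OF this, of i] show ?case by (simp add: add.assoc single_add[symmetric])
    qed (use single in simp)
    then show ?case .
  next
    case (add u w)
    then show ?case by (metis add.assoc)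
  qed
  from this[OF \<open>P 0\<close>] show ?thesis by simp
qed

lemma polynomial_induct [case_names Const Var add mult]:
  fixes f :: "('n, 'a::{comm_ring, comm_monoid_mult}) polynomials"
  assumes Const: "\<And>a. P (Const a)" and Var: "\<And>i. P (Var i)"
    and add: "\<And>f g. P f \<Longrightarrow> P g \<Longrightarrow> P (f + g)"
    and mult: "\<And>f g. P f \<Longrightarrow> P g \<Longrightarrow> P (f * g)"
  shows "P f"
proof (induction f rule: poly_mapping_sum_induct)
  case (single u a)
  show ?case
  proof (induction u rule: exponent_induct)
    case zero
    show ?case using Const[of a] by (simp add: Const_def)
  next
    case (Var u i)
    then show ?case unfolding single_add_exponent_Var by (rule mult[OF _ assms(2)])
  qed
qed (rule add)

text \<open>
  Two brackets agree at \<open>(f, g)\<close> for \<open>f\<close> and \<open>g\<close> in subsets that are closed under sums and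
  products, by additivity and the product rule in either argument.
\<close>

lemma poisson_brackets_agree_on_generators:
  fixes B B' :: "('n, 'a::{comm_ring, comm_monoid_mult}) polynomials \<Rightarrow> _"
  assumes "poisson_algebra s B" "poisson_algebra s' B'"
    and CC: "\<And>a b. B (Const a) (Const b) = B' (Const a) (Const b)"
    and CV: "\<And>a i. B (Const a) (Var i) = B' (Const a) (Var i)"
    and VV: "\<And>i j. B (Var i) (Var j) = B' (Var i) (Var j)"
  shows "B = B'"
proof -
  interpret B: poisson_algebra s B by fact
  interpret B': poisson_algebra s' B' by fact
  note rules = B.br_add_left B'.br_add_left B.br_add_right B'.br_add_right
    B.leibniz B'.leibniz B.leibniz_left B'.leibniz_left
  have VC: "B (Var i) (Const a) = B' (Var i) (Const a)" for i a
    by (metis CV B.br_antisym B'.br_antisym)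
  have "B (Const a) g = B' (Const a) g" for a g
    by (induction g rule: polynomial_induct) (simp_all add: CC CV rules)
  moreover have "B (Var i) g = B' (Var i) g" for i g
    by (induction g rule: polynomial_induct) (simp_all add: VC VV rules)
  ultimately have "B f g = B' f g" for f g
    by (induction f rule: polynomial_induct) (simp_all add: rules)
  then show ?thesis by (simp add: fun_eq_iff)
qed

lemma laurent_monomial_inverse:
  "Poly_Mapping.single (- w) 1 * (Poly_Mapping.single w 1 * f) = (f :: ('n, 'a::{comm_ring, comm_monoid_mult}) laurent_polynomials)"
proof -
  have "Poly_Mapping.single 0 1 * f = f"
    by (induction f rule: poly_mapping_sum_induct) (simp_all add: mult_single distrib_left)
  then show ?thesis by (simp add: mult.assoc[symmetric] mult_single)
qed

lemma laurent_clear_denominators: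
  fixes f :: "('n, 'a::{comm_ring, comm_monoid_mult}) laurent_polynomials"
  obtains w p where "Poly_Mapping.single (Poly_Mapping.map int w) 1 * f = laurent_of_poly p"
proof -
  have "\<exists>w p. Poly_Mapping.single (Poly_Mapping.map int w) 1 * f = laurent_of_poly p"
  proof (induction f rule: poly_mapping_sum_induct)
    case (single u a)
    define w where "w = Poly_Mapping.map (\<lambda>k. nat (- k)) u"
    define v where "v = Poly_Mapping.map nat u"
    have "Poly_Mapping.map int w + u = Poly_Mapping.map int v"
      by (rule poly_mapping_eqI) (simp add: w_def v_def lookup_add lookup_map_int lookup_map_zero)
    then have "Poly_Mapping.single (Poly_Mapping.map int w) 1 * Poly_Mapping.single u a =
        laurent_of_poly (Poly_Mapping.single v a)"
      by (simp add: mult_single laurent_of_poly_single)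
    then show ?case by blast
  next
    case (add f g)
    then obtain w p w' p' where
      p: "Poly_Mapping.single (Poly_Mapping.map int w) 1 * f = laurent_of_poly p" and
      p': "Poly_Mapping.single (Poly_Mapping.map int w') 1 * g = laurent_of_poly p'" by blast
    let ?m = "\<lambda>w. Poly_Mapping.single (Poly_Mapping.map int w) (1::'a)"
    have "?m (w + w') * (f + g) = ?m w' * (?m w * f) + ?m w * (?m w' * g)"
      by (simp add: mult.assoc[symmetric] mult_single distrib_left map_int_add add.commute)
    also have "\<dots> = laurent_of_poly (Poly_Mapping.single w' 1 * p + Poly_Mapping.single w 1 * p')"
      unfolding p p'
      by (simp add: laurent_of_poly_mult laurent_of_poly_single additive.add[OF additive_laurent_of_poly])
    finally show ?case by blast
  qed
  then show ?thesis using that by blast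
qed

text \<open>
  If the derivations \<open>B q\<close> and \<open>B' q\<close> agree on polynomials, clear the denominator of
  \<open>f\<close>: from \<open>B q (m * f) = B' q (m * f)\<close> and \<open>B q m = B' q m\<close> one gets
  \<open>m * B q f = m * B' q f\<close>, and the monomial \<open>m\<close> is invertible. This is applied to each argument.
\<close>

lemma laurent_brackets_agree_on_polynomials:
  fixes B B' :: "('n, 'a::{comm_ring, comm_monoid_mult}) laurent_polynomials \<Rightarrow> _"
  assumes "poisson_algebra s B" "poisson_algebra s' B'"
    and eq: "\<And>f g. B (laurent_of_poly f) (laurent_of_poly g) = B' (laurent_of_poly f) (laurent_of_poly g)"
  shows "B = B'"
proof -
  interpret B: poisson_algebra s B by fact
  interpret B': poisson_algebra s' B' by fact
  have cancel: "B q f = B' q f"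
    if q: "\<And>p. B q (laurent_of_poly p) = B' q (laurent_of_poly p)" for q f
  proof -
    obtain w p where p: "Poly_Mapping.single (Poly_Mapping.map int w) 1 * f = laurent_of_poly p"
      by (rule laurent_clear_denominators)
    let ?m = "Poly_Mapping.single (Poly_Mapping.map int w) (1::'a)"
    have m: "B q ?m = B' q ?m"
      using q[of "Poly_Mapping.single w 1"] by (simp add: laurent_of_poly_single)
    have "B q (?m * f) = B' q (?m * f)" unfolding p by (rule q)
    then have "?m * B q f = ?m * B' q f" by (simp add: B.leibniz B'.leibniz m)
    then show ?thesis by (metis laurent_monomial_inverse)
  qed
  have "B q (laurent_of_poly p) = B' q (laurent_of_poly p)" for q p
    using cancel[OF eq, of p q] B.br_antisym B'.br_antisym by metis
  then have "B q f = B' q f" for q f by (rule cancel)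
  then show ?thesis by (simp add: fun_eq_iff)
qed

context commuting_poisson_pairs
begin

abbreviation poly_scale :: "'k \<Rightarrow> ('n, 'a) polynomials \<Rightarrow> ('n, 'a) polynomials" where
  "poly_scale \<equiv> coeff_scale scale"

sublocale laurent: poisson_algebra laurent_scale laurent_bracket
  by (rule poisson_algebra_laurent_bracket)

lemma laurent_of_poly_scale: "laurent_of_poly (poly_scale c f) = laurent_scale c (laurent_of_poly f)"
  by (induction f rule: poly_mapping_sum_induct)
     (simp_all add: coeff_scale_single laurent_of_poly_single additive.add[OF additive_laurent_of_poly]
       additive.add[OF additive_coeff_scale])

lemma \<alpha>_one: "\<alpha> i 1 = 0" and \<delta>_one: "\<delta> i 1 = 0" and br_one: "br a 1 = 0"
  using \<alpha>_mult[of i 1 1] \<delta>_mult[of i 1 1] leibniz[of a 1 1] by simp_all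

lemma laurent_bracket_Const_Const:
  "laurent_bracket (laurent_of_poly (Const a)) (laurent_of_poly (Const b)) = laurent_of_poly (Const (br a b))"
  by (simp add: laurent_bracket_def laurent_of_poly_Const euler_single coeff_bracket_single)

lemma laurent_bracket_Const_Var:
  "laurent_bracket (laurent_of_poly (Const a)) (laurent_of_poly (Var i)) =
     laurent_of_poly (Const (\<alpha> i a) * Var i + Const (\<delta> i a))"
proof -
  let ?c = "Poly_Mapping.single 0 a :: ('n, 'a) laurent_polynomials"
  let ?x = "Poly_Mapping.single (Poly_Mapping.single i 1) 1 :: ('n, 'a) laurent_polynomials"
  have "var_action j ?c * euler j ?x - euler j ?c * var_action j ?x =
      (if j = i then var_action i ?c * ?x else 0)" for j
    by (simp add: euler_single lookup_single)
  then have "laurent_bracket ?c ?x = (\<Sum>j\<in>UNIV. if j = i then var_action i ?c * ?x else 0)"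
    by (simp only: laurent_bracket_def) (simp add: coeff_bracket_single br_one)
  also have "\<dots> = var_action i ?c * ?x" by simp
  also have "\<dots> = Poly_Mapping.single (Poly_Mapping.single i 1) (\<alpha> i a) + Poly_Mapping.single 0 (\<delta> i a)"
    by (simp only: var_action_single distrib_right mult_single)
       (simp add: single_add[symmetric])
  also have "\<dots> = laurent_of_poly (Const (\<alpha> i a) * Var i + Const (\<delta> i a))"
    by (simp add: additive.add[OF additive_laurent_of_poly] laurent_of_poly_mult
        laurent_of_poly_Const laurent_of_poly_Var mult_single)
  finally show ?thesis by (simp only: laurent_of_poly_Const laurent_of_poly_Var)
qed

lemma laurent_bracket_Var_Var:
  "laurent_bracket (laurent_of_poly (Var i)) (laurent_of_poly (Var j)) = 0"
  by (simp add: laurent_bracket_def laurent_of_poly_Var euler_single coeff_bracket_single br_one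
      var_action_single \<alpha>_one \<delta>_one)

text \<open>
  The polynomials form a subalgebra, so by the product rule it is enough that brackets of
  constants and variables are polynomials. The negative power of \<open>x\<^sub>i\<close> in \<open>D\<^sub>i\<close> disappears because it
  is always multiplied by \<open>E\<^sub>i x\<^sub>i = x\<^sub>i\<close>.
\<close>

lemma laurent_bracket_polynomials:
  "laurent_bracket (laurent_of_poly f) (laurent_of_poly g) \<in> range laurent_of_poly"
proof -
  let ?R = "range laurent_of_poly :: ('n, 'a) laurent_polynomials set"
  note hom = additive.add[OF additive_laurent_of_poly] laurent_of_poly_mult
  have plus: "x + y \<in> ?R" and times: "x * y \<in> ?R"
    if "x \<in> ?R" "y \<in> ?R" for x y
    using that by (auto simp: hom[symmetric])
  have VC: "laurent_bracket (laurent_of_poly (Var i)) (laurent_of_poly (Const a)) \<in> ?R" for i a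
    by (subst laurent.br_antisym)
       (simp add: laurent_bracket_Const_Var additive.minus[OF additive_laurent_of_poly, symmetric])
  have VV: "laurent_bracket (laurent_of_poly (Var i)) (laurent_of_poly (Var j)) \<in> ?R" for i j
    by (metis laurent_bracket_Var_Var rangeI additive.zero[OF additive_laurent_of_poly])
  have C: "laurent_bracket (laurent_of_poly (Const a)) (laurent_of_poly g) \<in> ?R" for a g
    by (induction g rule: polynomial_induct)
       (auto simp: laurent_bracket_Const_Const laurent_bracket_Const_Var hom laurent.br_add_right
         laurent.leibniz intro: plus times)
  have V: "laurent_bracket (laurent_of_poly (Var i)) (laurent_of_poly g) \<in> ?R" for i g
    by (induction g rule: polynomial_induct)
       (auto simp: VV VC hom laurent.br_add_right laurent.leibniz intro: plus times)
  show ?thesis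
    by (induction f rule: polynomial_induct)
       (auto simp: C V hom laurent.br_add_left laurent.leibniz_left intro: plus times)
qed

definition poly_bracket :: "('n, 'a) polynomials \<Rightarrow> ('n, 'a) polynomials \<Rightarrow> ('n, 'a) polynomials" where
  "poly_bracket f g = inv laurent_of_poly (laurent_bracket (laurent_of_poly f) (laurent_of_poly g))"

lemma laurent_of_poly_bracket:
  "laurent_of_poly (poly_bracket f g) = laurent_bracket (laurent_of_poly f) (laurent_of_poly g)"
  unfolding poly_bracket_def by (rule f_inv_into_f) (rule laurent_bracket_polynomials)

lemma poisson_algebra_poly_bracket: "poisson_algebra poly_scale poly_bracket"
proof -
  interpret poly: comm_algebra poly_scale by (rule comm_algebra_coeff_scale)
  note inj = injD[OF inj_laurent_of_poly]
  note hom = laurent_of_poly_bracket additive.add[OF additive_laurent_of_poly] laurent_of_poly_mult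
    laurent_of_poly_scale additive.zero[OF additive_laurent_of_poly]
  show ?thesis
    by (unfold_locales; rule inj)
       (simp_all add: hom laurent.br_add_left laurent.br_add_right laurent.br_scale_left
         laurent.br_scale_right laurent.br_self laurent.leibniz, rule laurent.jacobi)
qed

lemma poly_bracket_generators:
  shows "poly_bracket (Const a) (Const b) = Const (br a b)"
    and "poly_bracket (Const a) (Var i) = Const (\<alpha> i a) * Var i + Const (\<delta> i a)"
    and "poly_bracket (Var i) (Var j) = 0"
  by (rule injD[OF inj_laurent_of_poly]; simp add: laurent_of_poly_bracket laurent_bracket_Const_Const
      laurent_bracket_Const_Var laurent_bracket_Var_Var additive.zero[OF additive_laurent_of_poly])+

lemma poisson_poly_bracket_eq: "poisson_poly_bracket scale br \<alpha> \<delta> = poly_bracket"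
  unfolding poisson_poly_bracket_def
  by (rule the_equality)
     (auto simp: poisson_algebra_poly_bracket poly_bracket_generators
       intro!: poisson_brackets_agree_on_generators[OF _ poisson_algebra_poly_bracket])

lemma poisson_laurent_bracket_eq: "poisson_laurent_bracket scale br \<alpha> \<delta> = laurent_bracket"
  unfolding poisson_laurent_bracket_def poisson_poly_bracket_eq laurent_of_poly_bracket
  by (rule the_equality)
     (auto simp: poisson_algebra_laurent_bracket
       intro!: laurent_brackets_agree_on_polynomials[OF _ poisson_algebra_laurent_bracket])

end

section \<open>Chain conditions, Dickson's lemma and monomial orders\<close>

lemma poisson_ideal_generated: "poisson_ideal br (poisson_ideal_generated br S)"
  by (auto simp: poisson_ideal_def poisson_ideal_generated_def)

lemma poisson_ideal_generated_superset: "S \<subseteq> poisson_ideal_generated br S"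
  by (auto simp: poisson_ideal_generated_def)

lemma poisson_ideal_generated_least:
  "poisson_ideal br J \<Longrightarrow> S \<subseteq> J \<Longrightarrow> poisson_ideal_generated br S \<subseteq> J"
  by (auto simp: poisson_ideal_generated_def)

lemma poisson_ideal_minus:
  "poisson_ideal br I \<Longrightarrow> x \<in> I \<Longrightarrow> y \<in> I \<Longrightarrow> x - y \<in> I"
  by (metis (no_types, lifting) diff_conv_add_uminus poisson_ideal_def)

lemma (in poisson_noetherian) chain_stabilizes:
  assumes ideal: "\<And>k. poisson_ideal br (F k)" and "incseq F"
  shows "\<exists>N. \<forall>k\<ge>N. F k = F N"
proof -
  have common: "\<exists>k. x \<in> F k \<and> y \<in> F k" if xy: "x \<in> (\<Union>k. F k)" "y \<in> (\<Union>k. F k)" for x y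
  proof -
    obtain k l where "x \<in> F k" "y \<in> F l" using xy by blast
    then have "x \<in> F (max k l)" "y \<in> F (max k l)"
      using incseqD[OF \<open>incseq F\<close>, of k "max k l"] incseqD[OF \<open>incseq F\<close>, of l "max k l"] by auto
    then show ?thesis by blast
  qed
  have "x + y \<in> (\<Union>k. F k)" if xy: "x \<in> (\<Union>k. F k)" "y \<in> (\<Union>k. F k)" for x y
  proof -
    obtain k where "x \<in> F k" "y \<in> F k" using common[OF xy] by blast
    then have "x + y \<in> F k" using ideal[of k] by (simp add: poisson_ideal_def)
    then show ?thesis by blast
  qed
  note plus = this
  have union: "poisson_ideal br (\<Union>k. F k)"
    unfolding poisson_ideal_def
  proof (intro conjI ballI allI)
    show "0 \<in> (\<Union>k. F k)" using ideal[of 0] by (auto simp: poisson_ideal_def)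
    fix x a assume "x \<in> (\<Union>k. F k)"
    then obtain k where k: "x \<in> F k" by blast
    show "- x \<in> (\<Union>k. F k)" "a * x \<in> (\<Union>k. F k)" "br a x \<in> (\<Union>k. F k)"
      using ideal[of k] k by (auto simp: poisson_ideal_def intro!: exI[of _ k])
  qed (rule plus)
  obtain S where S: "finite S" "(\<Union>k. F k) = poisson_ideal_generated br S"
    using finitely_generated[OF union] by (elim exE conjE)
  have "\<exists>N. S \<subseteq> F N"
  proof -
    have "S \<subseteq> (\<Union>k. F k)" unfolding S(2) by (rule poisson_ideal_generated_superset)
    with S(1) show ?thesis
    proof (induction S rule: finite_induct)
      case (insert x S)
      then obtain N l where "S \<subseteq> F N" "x \<in> F l" by blast
      then have "insert x S \<subseteq> F (max N l)"
        using incseqD[OF \<open>incseq F\<close>, of N "max N l"] incseqD[OF \<open>incseq F\<close>, of l "max N l"] by auto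
      then show ?case by blast
    qed simp
  qed
  then obtain N where "S \<subseteq> F N" by blast
  then have "(\<Union>k. F k) \<subseteq> F N"
    unfolding S(2) by (rule poisson_ideal_generated_least[OF ideal])
  then have "F k = F N" if "k \<ge> N" for k
    using incseqD[OF \<open>incseq F\<close> that] by blast
  then show ?thesis by blast
qed

text \<open>
  A decreasing sequence of natural numbers is constant from its least value on.
\<close>

lemma nat_sequence_monotone_subsequence:
  fixes s :: "nat \<Rightarrow> nat"
  shows "\<exists>r. strict_mono r \<and> incseq (\<lambda>k. s (r k))"
proof -
  obtain r :: "nat \<Rightarrow> nat" where r: "strict_mono r" "monoseq (\<lambda>k. s (r k))"
    using seq_monosub[of s] by blast
  then consider "incseq (\<lambda>k. s (r k))" | "decseq (\<lambda>k. s (r k))"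
    by (auto simp: monoseq_iff)
  then show ?thesis
  proof cases
    case 2
    obtain N where N: "\<And>k. s (r N) \<le> s (r k)"
      using ex_has_least_nat[of "\<lambda>_. True" 0 "\<lambda>k. s (r k)"] by auto
    then have "s (r (N + k)) = s (r N)" for k
      using decseqD[OF 2, of N "N + k"] by (simp add: le_antisym)
    then have "incseq (\<lambda>k. s (r (N + k)))" by (simp add: incseq_def)
    moreover have "strict_mono (\<lambda>k. r (N + k))"
      using r(1) by (simp add: strict_mono_def)
    ultimately show ?thesis by (intro exI[of _ "\<lambda>k. r (N + k)"]) simp
  qed (use r in blast)
qed

text \<open>
  Monotone subsequences are extracted for one coordinate after the other; there are finitely many.
\<close>

lemma dickson:
  fixes f :: "nat \<Rightarrow> ('n::finite \<Rightarrow>\<^sub>0 nat)"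
  obtains r :: "nat \<Rightarrow> nat" where "strict_mono r" "\<And>k l. k \<le> l \<Longrightarrow> \<exists>w. f (r l) = f (r k) + w"
proof -
  have "\<exists>r. strict_mono r \<and> (\<forall>i\<in>A. incseq (\<lambda>k. Poly_Mapping.lookup (f (r k)) i))" for A :: "'n set"
    using finite[of A]
  proof (induction A rule: finite_induct)
    case empty
    show ?case by (auto intro: exI[of _ id] simp: strict_mono_def)
  next
    case (insert j A)
    then obtain r where r: "strict_mono r" "\<And>i. i \<in> A \<Longrightarrow> incseq (\<lambda>k. Poly_Mapping.lookup (f (r k)) i)"
      by blast
    obtain r' where r': "strict_mono r'" "incseq (\<lambda>k. Poly_Mapping.lookup (f (r (r' k))) j)"
      using nat_sequence_monotone_subsequence[of "\<lambda>k. Poly_Mapping.lookup (f (r k)) j"] by blast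
    have "incseq (\<lambda>k. Poly_Mapping.lookup (f (r (r' k))) i)" if "i \<in> A" for i
      using r(2)[OF that] r'(1) by (simp add: incseq_def strict_mono_less_eq)
    then show ?case using r(1) r' strict_mono_o[OF r(1) r'(1)]
      by (intro exI[of _ "r \<circ> r'"]) (auto simp: o_def)
  qed
  from this[of UNIV] obtain r
    where r: "strict_mono r" "\<And>i. incseq (\<lambda>k. Poly_Mapping.lookup (f (r k)) i)"
    by blast
  have "f (r l) = f (r k) + (f (r l) - f (r k))" if "k \<le> l" for k l
    using incseqD[OF r(2) that]
    by (intro poly_mapping_eqI) (simp add: lookup_add lookup_minus)
  then show ?thesis by (intro that[OF r(1)] exI)
qed

text \<open>
  \<open>M\<close> is the set of exponents at which \<open>F\<close> differs from its value at every proper divisor. If \<open>M\<close>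
  were infinite, then by Dickson's lemma it would contain a sequence of distinct exponents, each
  dividing the next; along it \<open>F\<close> ascends, so it eventually stays constant, contradicting the choice
  of \<open>M\<close>. Descending from \<open>v\<close> through divisors with the same value of \<open>F\<close> ends in \<open>M\<close>.
\<close>

lemma finitely_many_jumps:
  fixes F :: "('n::finite \<Rightarrow>\<^sub>0 nat) \<Rightarrow> 'b set"
  assumes mono: "\<And>u w. F u \<subseteq> F (u + w)"
    and acc: "\<And>s :: nat \<Rightarrow> 'n \<Rightarrow>\<^sub>0 nat. incseq (\<lambda>k. F (s k)) \<Longrightarrow> \<exists>N. \<forall>k\<ge>N. F (s k) = F (s N)"
  obtains M where "finite M" "\<And>v. \<exists>u\<in>M. \<exists>w. v = u + w \<and> F v = F u"
proof
  define M where "M = {v. \<forall>u w. v = u + w \<and> F v = F u \<longrightarrow> w = 0}"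
  show "finite M"
  proof (rule ccontr)
    assume "infinite M"
    then obtain s :: "nat \<Rightarrow> _" where s: "inj s" "range s \<subseteq> M"
      using infinite_countable_subset by blast
    obtain r :: "nat \<Rightarrow> nat"
      where r: "strict_mono r" "\<And>k l. k \<le> l \<Longrightarrow> \<exists>w. s (r l) = s (r k) + w"
      using dickson[of s] by blast
    have "incseq (\<lambda>k. F (s (r k)))"
      unfolding incseq_def using r(2) mono by metis
    then obtain N where N: "\<And>k. k \<ge> N \<Longrightarrow> F (s (r k)) = F (s (r N))"
      using acc[of "\<lambda>k. s (r k)"] by blast
    obtain w where w: "s (r (Suc N)) = s (r N) + w" using r(2)[of N "Suc N"] by auto
    moreover have "s (r (Suc N)) \<in> M" using s(2) by auto
    ultimately have "w = 0" using N[of "Suc N"] unfolding M_def by auto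
    with w have "r (Suc N) = r N" using s(1) by (simp add: inj_eq)
    with r(1) show False by (metis lessI less_irrefl strict_mono_less)
  qed
  define deg where "deg v = (\<Sum>i\<in>UNIV. Poly_Mapping.lookup v i)" for v :: "'n \<Rightarrow>\<^sub>0 nat"
  have deg_less: "deg u < deg (u + w)" if w: "w \<noteq> 0" for u w
  proof -
    obtain i where "Poly_Mapping.lookup w i \<noteq> 0"
      using w by (metis lookup_zero poly_mapping_eqI)
    then have "deg w > 0" unfolding deg_def by (metis finite sum_eq_0_iff UNIV_I gr0I)
    then show ?thesis by (simp add: deg_def lookup_add sum.distrib)
  qed
  show "\<exists>u\<in>M. \<exists>w. v = u + w \<and> F v = F u" for v
  proof (induction v rule: measure_induct_rule[of deg])
    case (less v)
    show ?case
    proof (cases "v \<in> M")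
      case True
      then show ?thesis by (metis add.right_neutral)
    next
      case False
      then obtain u w where u: "v = u + w" "F v = F u" "w \<noteq> 0" unfolding M_def by blast
      then have "deg u < deg v" using deg_less by simp
      from less[OF this] obtain u' w' where "u' \<in> M" "u = u' + w'" "F u = F u'" by blast
      then show ?thesis using u by (intro bexI[of _ u'] exI[of _ "w' + w"]) (simp_all add: add.assoc)
    qed
  qed
qed

locale monomial_order =
  fixes R :: "('n \<Rightarrow>\<^sub>0 nat) rel"
  assumes wf: "wf R" and trans: "trans R" and total: "total R"
    and translate: "(u, v) \<in> R \<Longrightarrow> (u + w, v + w) \<in> R"
    and less_Var: "(u, u + Poly_Mapping.single i 1) \<in> R"
begin

abbreviation below :: "('n \<Rightarrow>\<^sub>0 nat) \<Rightarrow> ('n \<Rightarrow>\<^sub>0 nat) set" where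
  "below u \<equiv> R\<inverse> `` {u}"

lemma finite_has_greatest:
  assumes "finite A" "A \<noteq> {}"
  shows "\<exists>m\<in>A. A \<subseteq> insert m (below m)"
  using assms
proof (induction A rule: finite_ne_induct)
  case (insert x A)
  then obtain m where m: "m \<in> A" "A \<subseteq> insert m (below m)" by blast
  consider "x = m" | "(x, m) \<in> R" | "(m, x) \<in> R"
    using total by (auto simp: total_on_def)
  then show ?case
  proof cases
    case 3
    then have "A \<subseteq> below x" using m(2) trans by (auto dest: transD)
    then show ?thesis by blast
  qed (use m in auto)
qed simp

end

text \<open>
  The lexicographic order with respect to an enumeration of the variables. It is well-founded
  because it compares lists of one fixed length.
\<close>

lemma ex_monomial_order: "\<exists>R :: ('n::finite \<Rightarrow>\<^sub>0 nat) rel. monomial_order R"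
proof -
  obtain xs :: "'n list" where xs: "set xs = UNIV" using finite_list[OF finite] by blast
  let ?l = "\<lambda>xs u. map (Poly_Mapping.lookup u) xs"
  let ?R = "inv_image (lex less_than) (?l xs)"
  have "(?l ys u, ?l ys v) \<in> lex less_than \<or> (?l ys v, ?l ys u) \<in> lex less_than \<or>
      (\<forall>i\<in>set ys. Poly_Mapping.lookup u i = Poly_Mapping.lookup v i)" for u v :: "'n \<Rightarrow>\<^sub>0 nat" and ys
    by (induction ys) (auto simp: less_than_iff)
  from this[of _ xs] have "total ?R"
    by (simp add: total_on_def xs) (metis poly_mapping_eqI)
  moreover have "(?l ys u, ?l ys v) \<in> lex less_than \<Longrightarrow> (?l ys (u + w), ?l ys (v + w)) \<in> lex less_than"
    for u v w :: "'n \<Rightarrow>\<^sub>0 nat" and ys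
    by (induction ys) (auto simp: lookup_add)
  moreover have "i \<in> set ys \<Longrightarrow> (?l ys u, ?l ys (u + Poly_Mapping.single i 1)) \<in> lex less_than"
    for u :: "'n \<Rightarrow>\<^sub>0 nat" and i ys
    by (induction ys) (auto simp: lookup_add lookup_single when_def)
  ultimately have order: "total ?R" "(u, v) \<in> ?R \<Longrightarrow> (u + w, v + w) \<in> ?R" "(u, u + Poly_Mapping.single i 1) \<in> ?R" for u v w i
    by (simp_all add: xs)
  have "monomial_order ?R"
  proof
    show "wf ?R" by (intro wf_inv_image wf_lex wf_less_than)
    show "trans ?R" by (intro trans_inv_image lex_transI trans_less_than)
  qed (fact order)+
  then show ?thesis by blast
qed

section \<open>Leading coefficients and the basis theorem\<close>

lemma keys_add_subset: "Poly_Mapping.keys f \<subseteq> X \<Longrightarrow> Poly_Mapping.keys g \<subseteq> X \<Longrightarrow> Poly_Mapping.keys (f + g) \<subseteq> X"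
  using keys_add[of f g] by blast

lemma keys_uminus: "Poly_Mapping.keys (- f) = Poly_Mapping.keys (f :: 'e \<Rightarrow>\<^sub>0 'a::ab_group_add)"
  by (auto simp: in_keys_iff)

lemma keys_minus_subset:
  "Poly_Mapping.keys f \<subseteq> X \<Longrightarrow> Poly_Mapping.keys g \<subseteq> X \<Longrightarrow>
   Poly_Mapping.keys (f - g :: 'e \<Rightarrow>\<^sub>0 'a::ab_group_add) \<subseteq> X"
  by (metis diff_conv_add_uminus keys_add_subset keys_uminus)

lemma (in monomial_order) keys_single_mult_below:
  assumes "Poly_Mapping.keys r \<subseteq> below u"
  shows "Poly_Mapping.keys (Poly_Mapping.single w a * r) \<subseteq> below (u + w)"
proof
  fix v assume "v \<in> Poly_Mapping.keys (Poly_Mapping.single w a * r)"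
  then obtain w' v' where "v = w' + v'" "w' \<in> Poly_Mapping.keys (Poly_Mapping.single w a)"
    "v' \<in> Poly_Mapping.keys r"
    using keys_mult[of "Poly_Mapping.single w a" r] by blast
  moreover from this have "w' = w" by (simp split: if_splits)
  ultimately show "v \<in> below (u + w)" using assms translate by (auto simp: add.commute)
qed

locale ordered_poisson_pairs = commuting_poisson_pairs scale br \<alpha> \<delta> + monomial_order R
  for scale :: "'k::{comm_ring, comm_monoid_mult} \<Rightarrow> 'a::{comm_ring, comm_monoid_mult} \<Rightarrow> 'a"
    and br and \<alpha> \<delta> :: "'n::finite \<Rightarrow> 'a \<Rightarrow> 'a" and R :: "('n \<Rightarrow>\<^sub>0 nat) rel"
begin

sublocale poly: poisson_algebra poly_scale poly_bracket
  by (rule poisson_algebra_poly_bracket)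

text \<open>
  The element \<open>t\<close> is \<open>\<Sum>i. u\<^sub>i \<alpha>\<^sub>i a\<close>, the derivation \<open>{a, -}\<close> applied to the monomial \<open>x\<^sup>u\<close>, up to
  lower terms. Induction
  on \<open>u\<close> with the product rule: a further factor \<open>x\<^sub>i\<close> adds \<open>\<alpha>\<^sub>i a\<close> to \<open>t\<close>, and \<open>\<delta>\<^sub>i a\<close> appears
  only at the smaller exponent.
\<close>

lemma poly_bracket_Const_single:
  "\<exists>t. \<forall>c. \<exists>r. Poly_Mapping.keys r \<subseteq> below u \<and>
     poly_bracket (Const a) (Poly_Mapping.single u c) = Poly_Mapping.single u (br a c + t * c) + r"
proof (induction u rule: exponent_induct)
  case zero
  show ?case
    using poly_bracket_generators(1)[of a] by (intro exI[of _ 0]) (auto simp: Const_def intro: exI[of _ 0])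
next
  case (Var u i)
  then obtain t where t: "\<And>c. \<exists>r. Poly_Mapping.keys r \<subseteq> below u \<and>
     poly_bracket (Const a) (Poly_Mapping.single u c) = Poly_Mapping.single u (br a c + t * c) + r" by blast
  let ?v = "u + Poly_Mapping.single i 1"
  have "\<exists>r. Poly_Mapping.keys r \<subseteq> below ?v \<and>
      poly_bracket (Const a) (Poly_Mapping.single ?v c) = Poly_Mapping.single ?v (br a c + (t + \<alpha> i a) * c) + r" for c
  proof -
    obtain r where r: "Poly_Mapping.keys r \<subseteq> below u"
      "poly_bracket (Const a) (Poly_Mapping.single u c) = Poly_Mapping.single u (br a c + t * c) + r"
      using t by blast
    let ?r = "Var i * r + Poly_Mapping.single u (c * \<delta> i a)"
    have "poly_bracket (Const a) (Poly_Mapping.single ?v c) =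
        (Poly_Mapping.single u (br a c + t * c) + r) * Var i +
        Poly_Mapping.single u c * (Const (\<alpha> i a) * Var i + Const (\<delta> i a))"
      by (simp only: single_add_exponent_Var poly.leibniz r(2) poly_bracket_generators(2))
    also have "\<dots> = Poly_Mapping.single ?v (br a c + (t + \<alpha> i a) * c) + ?r"
      by (simp add: Const_def Var_def distrib_left distrib_right mult_single single_add ac_simps)
    finally have "poly_bracket (Const a) (Poly_Mapping.single ?v c) =
      Poly_Mapping.single ?v (br a c + (t + \<alpha> i a) * c) + ?r" .
    moreover have "Poly_Mapping.keys (Var i * r) \<subseteq> below ?v"
      unfolding Var_def by (rule keys_single_mult_below[OF r(1)])
    then have "Poly_Mapping.keys ?r \<subseteq> below ?v"
      using less_Var[of u i] by (intro keys_add_subset) auto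
    ultimately show ?thesis by blast
  qed
  then show ?case by blast
qed

definition leading_coeffs :: "('n, 'a) polynomials set \<Rightarrow> ('n \<Rightarrow>\<^sub>0 nat) \<Rightarrow> 'a set" where
  "leading_coeffs I u = {c. \<exists>r. Poly_Mapping.keys r \<subseteq> below u \<and> Poly_Mapping.single u c + r \<in> I}"

lemma leading_coeffsI:
  "Poly_Mapping.keys r \<subseteq> below u \<Longrightarrow> Poly_Mapping.single u c + r \<in> I \<Longrightarrow> c \<in> leading_coeffs I u"
  unfolding leading_coeffs_def by blast

lemma poly_bracket_Const_below:
  assumes "Poly_Mapping.keys r \<subseteq> below u"
  shows "Poly_Mapping.keys (poly_bracket (Const a) r) \<subseteq> below u"
proof -
  have single: "Poly_Mapping.keys (poly_bracket (Const a) (Poly_Mapping.single v c)) \<subseteq> below u" if "v \<in> below u" for v c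
  proof -
    obtain d r where r: "Poly_Mapping.keys r \<subseteq> below v"
       "poly_bracket (Const a) (Poly_Mapping.single v c) = Poly_Mapping.single v d + r"
      using poly_bracket_Const_single[of v a] by blast
    have "below v \<subseteq> below u" using that trans by (auto dest: transD)
    then show ?thesis unfolding r(2) using r(1) that by (intro keys_add_subset) auto
  qed
  have "r = (\<Sum>v\<in>Poly_Mapping.keys r. Poly_Mapping.single v (Poly_Mapping.lookup r v))"
    by (rule poly_mapping_eqI) (simp add: lookup_sum lookup_single when_def in_keys_iff)
  then have "poly_bracket (Const a) r =
      (\<Sum>v\<in>Poly_Mapping.keys r. poly_bracket (Const a) (Poly_Mapping.single v (Poly_Mapping.lookup r v)))"
    by (metis additive.sum[OF poly.additive_br_right])
  also have "Poly_Mapping.keys \<dots> \<subseteq> below u"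
    using keys_sum single assms by (smt (verit) UN_E subset_iff)
  finally show ?thesis .
qed

text \<open>
  For closure under brackets, apply \<open>{a, -}\<close> to an element with leading term \<open>c x\<^sup>u\<close>. The new
  leading coefficient is \<open>{a, c} + t c\<close>, and subtracting \<open>t\<close> times the old one leaves \<open>{a, c}\<close>.
\<close>

lemma poisson_ideal_leading_coeffs:
  assumes I: "poisson_ideal poly_bracket I"
  shows "poisson_ideal br (leading_coeffs I u)"
  unfolding poisson_ideal_def
proof (intro conjI ballI allI)
  have I_rules: "0 \<in> I" "f \<in> I \<Longrightarrow> g \<in> I \<Longrightarrow> f + g \<in> I" "f \<in> I \<Longrightarrow> - f \<in> I"
    "f \<in> I \<Longrightarrow> h * f \<in> I" "f \<in> I \<Longrightarrow> poly_bracket h f \<in> I" for f g h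
    using I unfolding poisson_ideal_def by auto
  show "0 \<in> leading_coeffs I u"
    using I_rules(1) by (intro leading_coeffsI[of 0]) auto
  fix c assume "c \<in> leading_coeffs I u"
  then obtain r where r: "Poly_Mapping.keys r \<subseteq> below u" "Poly_Mapping.single u c + r \<in> I"
    unfolding leading_coeffs_def by blast
  show "- c \<in> leading_coeffs I u"
    using r(1) I_rules(3)[OF r(2)]
    by (intro leading_coeffsI[of "- r"]) (simp_all add: keys_uminus single_uminus)
  have mult: "a * c \<in> leading_coeffs I u" for a
  proof (rule leading_coeffsI)
    show "Poly_Mapping.keys (Const a * r) \<subseteq> below u"
      using keys_single_mult_below[OF r(1), of 0 a] by (simp add: Const_def)
    show "Poly_Mapping.single u (a * c) + Const a * r \<in> I"
      using I_rules(4)[OF r(2), of "Const a"] by (simp add: Const_def distrib_left mult_single)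
  qed
  then show "a * c \<in> leading_coeffs I u" for a .
  have add: "c + d \<in> leading_coeffs I u" if c: "c \<in> leading_coeffs I u" and "d \<in> leading_coeffs I u" for c d
  proof -
    from that obtain r q where "Poly_Mapping.keys r \<subseteq> below u" "Poly_Mapping.single u c + r \<in> I"
      "Poly_Mapping.keys q \<subseteq> below u" "Poly_Mapping.single u d + q \<in> I"
      unfolding leading_coeffs_def by blast
    then show ?thesis
      using I_rules(2)[of "Poly_Mapping.single u c + r" "Poly_Mapping.single u d + q"]
      by (intro leading_coeffsI[of "r + q"] keys_add_subset) (simp_all add: single_add ac_simps)
  qed
  then show "c + d \<in> leading_coeffs I u" if "d \<in> leading_coeffs I u" for d
    using that \<open>c \<in> leading_coeffs I u\<close> by blast
  show "br a c \<in> leading_coeffs I u" for a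
  proof -
    obtain t q where q: "Poly_Mapping.keys q \<subseteq> below u"
      "poly_bracket (Const a) (Poly_Mapping.single u c) = Poly_Mapping.single u (br a c + t * c) + q"
      using poly_bracket_Const_single by blast
    have "br a c + t * c \<in> leading_coeffs I u"
    proof (rule leading_coeffsI)
      show "Poly_Mapping.keys (q + poly_bracket (Const a) r) \<subseteq> below u"
        by (intro keys_add_subset q poly_bracket_Const_below r)
      show "Poly_Mapping.single u (br a c + t * c) + (q + poly_bracket (Const a) r) \<in> I"
        using I_rules(5)[OF r(2), of "Const a"] by (simp add: poly.br_add_right q add.assoc)
    qed
    from add[OF this mult[of "- t"]] show ?thesis by simp
  qed
qed

lemma leading_coeffs_mono_exponent:
  assumes I: "poisson_ideal poly_bracket I"
  shows "leading_coeffs I u \<subseteq> leading_coeffs I (u + w)"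
proof
  fix c assume "c \<in> leading_coeffs I u"
  then obtain r where r: "Poly_Mapping.keys r \<subseteq> below u" "Poly_Mapping.single u c + r \<in> I"
    unfolding leading_coeffs_def by blast
  show "c \<in> leading_coeffs I (u + w)"
  proof (rule leading_coeffsI)
    show "Poly_Mapping.keys (Poly_Mapping.single w 1 * r) \<subseteq> below (u + w)"
      by (rule keys_single_mult_below[OF r(1)])
    have "Poly_Mapping.single w 1 * (Poly_Mapping.single u c + r) \<in> I"
      using I r(2) unfolding poisson_ideal_def by blast
    then show "Poly_Mapping.single (u + w) c + Poly_Mapping.single w 1 * r \<in> I"
      by (simp add: distrib_left mult_single add.commute)
  qed
qed

text \<open>
  Division with remainder: subtracting from \<open>f \<in> I\<close> an element of \<open>J\<close> with the same leading
  term gives an element of \<open>I\<close> with a smaller leading exponent, and the order is well-founded.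
\<close>

lemma ideal_subset_if_leading_coeffs_subset:
  assumes I: "poisson_ideal poly_bracket I" and J: "poisson_ideal poly_bracket J"
    and "J \<subseteq> I" and lc: "\<And>u. leading_coeffs I u \<subseteq> leading_coeffs J u"
  shows "I \<subseteq> J"
proof -
  have *: "\<forall>f\<in>I. Poly_Mapping.keys f \<subseteq> insert u (below u) \<longrightarrow> f \<in> J" for u
  proof (induction u rule: wf_induct_rule[OF wf])
    case (1 u)
    show ?case
    proof (intro ballI impI)
      fix f assume f: "f \<in> I" "Poly_Mapping.keys f \<subseteq> insert u (below u)"
      let ?c = "Poly_Mapping.lookup f u"
      have "Poly_Mapping.lookup (f - Poly_Mapping.single u ?c) u = 0" by (simp add: lookup_minus)
      moreover have "Poly_Mapping.keys (f - Poly_Mapping.single u ?c) \<subseteq> insert u (below u)"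
        using f(2) by (intro keys_minus_subset) auto
      ultimately have below: "Poly_Mapping.keys (f - Poly_Mapping.single u ?c) \<subseteq> below u"
        by (auto simp: in_keys_iff)
      then have "?c \<in> leading_coeffs I u"
        using f(1) by (intro leading_coeffsI[OF below]) simp
      then obtain r where r: "Poly_Mapping.keys r \<subseteq> below u" "Poly_Mapping.single u ?c + r \<in> J"
        using lc unfolding leading_coeffs_def by blast
      let ?g = "f - (Poly_Mapping.single u ?c + r)"
      have "?g \<in> I" using f(1) r(2) \<open>J \<subseteq> I\<close> by (intro poisson_ideal_minus[OF I]) auto
      have g: "Poly_Mapping.keys ?g \<subseteq> below u"
        using keys_minus_subset[OF below r(1)] by (simp add: diff_diff_eq)
      have "?g \<in> J"
      proof (cases "?g = 0")
        case True
        then show ?thesis using J by (simp add: poisson_ideal_def)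
      next
        case False
        then have "Poly_Mapping.keys ?g \<noteq> {}" by (metis in_keys_iff empty_iff lookup_zero poly_mapping_eqI)
        then obtain m where m: "m \<in> Poly_Mapping.keys ?g" "Poly_Mapping.keys ?g \<subseteq> insert m (below m)"
          using finite_has_greatest[OF finite_keys] by blast
        then have "(m, u) \<in> R" using g by blast
        from 1[OF this] show ?thesis using \<open>?g \<in> I\<close> m(2) by blast
      qed
      then have "?g + (Poly_Mapping.single u ?c + r) \<in> J"
        using r(2) J unfolding poisson_ideal_def by blast
      then show "f \<in> J" by simp
    qed
  qed
  show ?thesis
  proof
    fix f assume "f \<in> I"
    show "f \<in> J"
    proof (cases "Poly_Mapping.keys f = {}")
      case True
      then show ?thesis using * \<open>f \<in> I\<close> by blast
    next
      case False
      then show ?thesis using finite_has_greatest[OF finite_keys] * \<open>f \<in> I\<close> by blast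
    qed
  qed
qed

text \<open>
  \<open>S\<close> consists of elements of \<open>I\<close> whose leading coefficients generate the ideal \<open>I\<^sub>u\<close>, for each of the
  finitely many jumps \<open>u\<close>. At any other exponent \<open>v\<close> the ideal \<open>I\<^sub>v\<close> is already reached at some jump
  dividing \<open>v\<close>.
\<close>

lemma poisson_noetherian_poly:
  assumes "poisson_noetherian scale br"
  shows "poisson_noetherian poly_scale poly_bracket"
proof
  interpret A: poisson_noetherian scale br by fact
  fix I assume I: "poisson_ideal poly_bracket I"
  let ?F = "leading_coeffs I"
  obtain M where M: "finite M" "\<And>v. \<exists>u\<in>M. \<exists>w. v = u + w \<and> ?F v = ?F u"
    using finitely_many_jumps[of ?F] leading_coeffs_mono_exponent[OF I]
      A.chain_stabilizes[OF poisson_ideal_leading_coeffs[OF I]] by metis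
  have "\<exists>T. finite T \<and> ?F u = poisson_ideal_generated br T" for u
    by (rule A.finitely_generated) (rule poisson_ideal_leading_coeffs[OF I])
  then obtain T where T: "\<And>u. finite (T u)" "\<And>u. ?F u = poisson_ideal_generated br (T u)" by metis
  have "\<exists>r. c \<in> T u \<longrightarrow> Poly_Mapping.keys r \<subseteq> below u \<and> Poly_Mapping.single u c + r \<in> I" for u c
    using T(2)[of u] poisson_ideal_generated_superset[of "T u" br] unfolding leading_coeffs_def by blast
  then have "\<exists>r. \<forall>u c. c \<in> T u \<longrightarrow> Poly_Mapping.keys (r u c) \<subseteq> below u \<and> Poly_Mapping.single u c + r u c \<in> I"
    by (intro choice allI)
  then obtain r where r: "\<And>u c. c \<in> T u \<Longrightarrow> Poly_Mapping.keys (r u c) \<subseteq> below u"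
    "\<And>u c. c \<in> T u \<Longrightarrow> Poly_Mapping.single u c + r u c \<in> I" by blast
  define S where "S = (\<Union>u\<in>M. (\<lambda>c. Poly_Mapping.single u c + r u c) ` T u)"
  define J where "J = poisson_ideal_generated poly_bracket S"
  have J: "poisson_ideal poly_bracket J" unfolding J_def by (rule poisson_ideal_generated)
  have "S \<subseteq> I" using r(2) by (auto simp: S_def)
  then have "J \<subseteq> I" unfolding J_def by (rule poisson_ideal_generated_least[OF I])
  have "?F v \<subseteq> leading_coeffs J v" for v
  proof -
    obtain u w where u: "u \<in> M" "v = u + w" "?F v = ?F u" using M(2) by blast
    have "T u \<subseteq> leading_coeffs J u"
    proof
      fix c assume "c \<in> T u"
      moreover from this have "Poly_Mapping.single u c + r u c \<in> J"
        using u(1) poisson_ideal_generated_superset[of S poly_bracket] by (auto simp: J_def S_def)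
      ultimately show "c \<in> leading_coeffs J u" using r(1) by (intro leading_coeffsI)
    qed
    then have "?F u \<subseteq> leading_coeffs J u"
      unfolding T(2) by (rule poisson_ideal_generated_least[OF poisson_ideal_leading_coeffs[OF J]])
    then show ?thesis using leading_coeffs_mono_exponent[OF J] u by blast
  qed
  then have "I = J"
    using ideal_subset_if_leading_coeffs_subset[OF I J \<open>J \<subseteq> I\<close>] \<open>J \<subseteq> I\<close> by blast
  moreover have "finite S" using M(1) T(1) by (simp add: S_def)
  ultimately show "\<exists>S. finite S \<and> I = poisson_ideal_generated poly_bracket S"
    unfolding J_def by blast
qed

end

text \<open>
  Generators of the contraction of \<open>I\<close> to the polynomials also generate \<open>I\<close>: a Poisson ideal
  containing them contains, by contraction, all polynomials in \<open>I\<close>, and every element of \<open>I\<close> is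
  such a polynomial divided by a monomial.
\<close>

lemma (in commuting_poisson_pairs) poisson_noetherian_laurent:
  assumes "poisson_noetherian poly_scale poly_bracket"
  shows "poisson_noetherian laurent_scale laurent_bracket"
proof
  interpret poly: poisson_noetherian poly_scale poly_bracket by fact
  fix I assume I: "poisson_ideal laurent_bracket I"
  have contraction: "poisson_ideal poly_bracket (laurent_of_poly -` J)" if "poisson_ideal laurent_bracket J" for J
    using that
    by (simp add: poisson_ideal_def laurent_of_poly_bracket laurent_of_poly_mult
        additive.zero[OF additive_laurent_of_poly] additive.minus[OF additive_laurent_of_poly]
        additive.add[OF additive_laurent_of_poly])
  obtain S where S: "finite S" "laurent_of_poly -` I = poisson_ideal_generated poly_bracket S"
    using poly.finitely_generated[OF contraction[OF I]] by blast
  let ?J = "poisson_ideal_generated laurent_bracket (laurent_of_poly ` S)"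
  have J: "poisson_ideal laurent_bracket ?J" by (rule poisson_ideal_generated)
  have "S \<subseteq> laurent_of_poly -` I" unfolding S(2) by (rule poisson_ideal_generated_superset)
  then have "?J \<subseteq> I" by (intro poisson_ideal_generated_least[OF I]) auto
  moreover have "I \<subseteq> ?J"
  proof
    fix f assume "f \<in> I"
    obtain w p where p: "Poly_Mapping.single (Poly_Mapping.map int w) 1 * f = laurent_of_poly p"
      by (rule laurent_clear_denominators)
    have "laurent_of_poly p \<in> I"
      unfolding p[symmetric] using I \<open>f \<in> I\<close> unfolding poisson_ideal_def by blast
    moreover have "laurent_of_poly -` I \<subseteq> laurent_of_poly -` ?J"
      unfolding S(2) using poisson_ideal_generated_superset[of "laurent_of_poly ` S" laurent_bracket]
      by (intro poisson_ideal_generated_least contraction[OF J]) auto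
    ultimately have "laurent_of_poly p \<in> ?J" by blast
    then have "Poly_Mapping.single (- Poly_Mapping.map int w) 1 * laurent_of_poly p \<in> ?J"
      using J unfolding poisson_ideal_def by blast
    then show "f \<in> ?J" unfolding p[symmetric] by (simp add: laurent_monomial_inverse)
  qed
  ultimately show "\<exists>S. finite S \<and> I = poisson_ideal_generated laurent_bracket S"
    using S(1) by (intro exI[of _ "laurent_of_poly ` S"]) auto
qed

theorem theorem6:
  fixes scale :: "'k::{comm_ring, comm_monoid_mult} \<Rightarrow> 'a::{comm_ring, comm_monoid_mult} \<Rightarrow> 'a"
    and br :: "'a \<Rightarrow> 'a \<Rightarrow> 'a"
    and \<alpha> \<delta> :: "'n::finite \<Rightarrow> 'a \<Rightarrow> 'a"
  assumes "poisson_noetherian scale br"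
    and "\<And>i. poisson_pair scale br (\<alpha> i) (\<delta> i)"
    and "\<And>i j. i \<noteq> j \<Longrightarrow>
           \<alpha> i \<circ> \<alpha> j = \<alpha> j \<circ> \<alpha> i \<and> \<alpha> i \<circ> \<delta> j = \<delta> j \<circ> \<alpha> i \<and>
           \<delta> i \<circ> \<alpha> j = \<alpha> j \<circ> \<delta> i \<and> \<delta> i \<circ> \<delta> j = \<delta> j \<circ> \<delta> i"
  shows "poisson_noetherian (coeff_scale scale :: 'k \<Rightarrow> ('n, 'a) polynomials \<Rightarrow> _)
           (poisson_poly_bracket scale br \<alpha> \<delta>) \<and>
         poisson_noetherian (coeff_scale scale :: 'k \<Rightarrow> ('n, 'a) laurent_polynomials \<Rightarrow> _)
           (poisson_laurent_bracket scale br \<alpha> \<delta>)"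
proof -
  interpret A: poisson_noetherian scale br by fact
  interpret commuting_poisson_pairs scale br \<alpha> \<delta>
    by unfold_locales (rule assms)+
  obtain R :: "('n \<Rightarrow>\<^sub>0 nat) rel" where "monomial_order R" using ex_monomial_order by blast
  then interpret monomial_order R .
  interpret ordered_poisson_pairs scale br \<alpha> \<delta> R ..
  show ?thesis
    unfolding poisson_poly_bracket_eq poisson_laurent_bracket_eq
    using poisson_noetherian_poly[OF assms(1)] poisson_noetherian_laurent by blast
qed

end
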